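(* Let $(\mathbf{X},\mathrm{dist},\mu)$, $\mathcal{L}$, $r_0$ and $PW_\omega(\mathcal{L})$ be as in the context. For a given $\alpha>0$ there exists a constant $0<\nu=\nu(\mathbf{X},\alpha)<1$ such that for any $\omega>0$ and every metric $\rho$-lattice $\mathbf{X}_\rho=\{x_j\}$ with $\rho=\nu\omega^{-1/2}$ (sufficiently small, i.e. $\rho\le r_0$), every function $f\in PW_\omega(\mathcal{L})$ is completely determined by its averages $$\langle f,\xi_j\rangle=|B(x_j,\rho)|^{-1/2}\int_{B(x_j,\rho)}f\,d\mu$$ and can be reconstructed from them in a stable way by using the dual-frame reconstruction formula $f=\sum_j\langle f,\xi_j\rangle\Theta_j$, where $\{\Theta_j\}$ is a dual frame. One can also use the frame algorithm (described in the context) for the frame of functionals $\langle\cdot,\xi_j\rangle$ in $PW_\omega(\mathcal{L})$.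
   Context: Setting. $(\mathbf{X},\mathrm{dist})$ is a metric space with locally compact separable topology, and $\mu$ is a positive Radon measure that is doubling: for some $D>0$, $0<|B(x,2r)|\le2^D|B(x,r)|$ for all $x\in\mathbf{X}$, $r>0$, where $B(x,r)$ is the open ball and $|B|=\mu(B)$. $\mathcal{L}$ is a non-negative self-adjoint operator, densely defined in the real Hilbert space $L_2(\mathbf{X})=L_2(\mathbf{X},\mu)$ (norm $\|\cdot\|$, inner product $\langle\cdot,\cdot\rangle$), whose associated symmetric bilinear form $\mathcal{E}$ (with $\mathcal{E}(f,g)=\langle\mathcal{L}f,g\rangle$ for $f,g\in\mathcal{D}(\mathcal{L})$) is a strongly local regular Dirichlet form with energy measure $d\Gamma(f,g)$, so $\mathcal{E}(f,g)=\int_{\mathbf{X}}d\Gamma(f,g)$ and in particular $\|\mathcal{L}^{1/2}f\|^2=\mathcal{E}(f,f)=\int_{\mathbf{X}}d\Gamma(f,f)$ for $f\in\mathcal{D}(\mathcal{E})$. Local Poincaré assumption: there are constants $C>0$, $r_0>0$ such that for all $f\in\mathcal{D}(\mathcal{L})$, $x\in\mathbf{X}$, $0<r\le r_0$, with $B=B(x,r)$ and $f_B=|B|^{-1}\int_B f\,d\mu$, $$\int_B|f-f_B|^2d\mu\le Cr^2\int_B d\Gamma(f,f).$$ $\rho$-lattice: $N(\mathbf{X})$ is a fixed constant such that for every sufficiently small $\rho>0$ there is a set $\{x_j\}\subset\mathbf{X}$ for which the balls $B(x_j,\rho/2)$ are pairwise disjoint and the balls $B(x_j,\rho)$ cover $\mathbf{X}$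 with multiplicity at most $N(\mathbf{X})$. Any such set is called a metric $\rho$-lattice. $\xi_j=|B(x_j,\rho)|^{-1/2}\chi_{B(x_j,\rho)}$, with $\chi_E$ the characteristic function of $E$. Paley-Wiener space: $PW_\omega(\mathcal{L})$ is the range of the spectral projector $\mathbf{1}_{[0,\omega]}(\sqrt{\mathcal{L}})$, where $\sqrt{\mathcal{L}}$ is the non-negative self-adjoint square root of $\mathcal{L}$ and $\mathbf{1}_{[0,\omega]}$ is the characteristic function of $[0,\omega]$. Frames: a set of vectors $\{\theta_v\}$ in a Hilbert space $H$ is a frame if there are $a,b>0$ with $a\|f\|^2\le\sum_v|\langle f,\theta_v\rangle|^2\le b\|f\|^2$ for all $f\in H$. Then there exists a dual frame $\{\Theta_v\}$ (not unique in general) with $f=\sum_v\langle f,\theta_v\rangle\Theta_v$ for all $f\in H$. Frame algorithm: let $\Phi f=\sum_v\langle f,\theta_v\rangle\theta_v$ be the frame operator on $H$, let $0<\tau<2/b$ be a relaxation parameter and $\eta=\max\{|1-\tau a|,|1-\tau b|\}<1$; put $f_0=0$ and $f_n=f_{n-1}+\tau\Phi(f-f_{n-1})$. Then $f_n\to f$ with $\|f-f_n\|\le\eta^n\|f\|$; for $\tau=2/(a+b)$ one has $\eta=(b-a)/(a+b)$.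
   Formalization: The scale ρ=νω^{-1/2} is kept only for ω≤1; for every ω>0 the scale ρ=νω^{-1} is used instead, since with PW_ω defined by 1_{[0,ω]}(√L) the printed claim fails for large ω (e.g. on the circle, by counting dimensions). *)

theory Defs
  imports "HOL-Analysis.Analysis"
begin

section \<open>The measure space\<close>

definition radon_measure :: "'a::metric_space measure \<Rightarrow> bool" where
  "radon_measure M \<longleftrightarrow>
     sets M = sets borel \<and>
     (\<forall>K. compact K \<longrightarrow> emeasure M K < \<infinity>) \<and>
     (\<forall>A\<in>sets borel. emeasure M A = (INF U\<in>{U. open U \<and> A \<subseteq> U}. emeasure M U)) \<and>
     (\<forall>U. open U \<longrightarrow> emeasure M U = (SUP K\<in>{K. compact K \<and> K \<subseteq> U}. emeasure M K))"

definition doubling_measure :: "'a::metric_space measure \<Rightarrow> real \<Rightarrow> bool" where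
  "doubling_measure M D \<longleftrightarrow>
     (\<forall>x r. 0 < r \<longrightarrow>
        0 < emeasure M (ball x (2 * r)) \<and>
        emeasure M (ball x (2 * r)) \<le> ennreal (2 powr D) * emeasure M (ball x r))"

section \<open>The real Hilbert space of square integrable functions\<close>

text \<open>Elements are represented by functions; equality in the Hilbert space is equality almost
  everywhere, and all the sets of functions below are closed under it.\<close>

definition L2 :: "'a measure \<Rightarrow> ('a \<Rightarrow> real) set" where
  "L2 M = {f \<in> borel_measurable M. integrable M (\<lambda>x. (f x)\<^sup>2)}"

definition l2_inner :: "'a measure \<Rightarrow> ('a \<Rightarrow> real) \<Rightarrow> ('a \<Rightarrow> real) \<Rightarrow> real" where
  "l2_inner M f g = (LINT x|M. f x * g x)"

definition l2_norm :: "'a measure \<Rightarrow> ('a \<Rightarrow> real) \<Rightarrow> real" where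
  "l2_norm M f = sqrt (l2_inner M f f)"

definition l2_eq :: "'a measure \<Rightarrow> ('a \<Rightarrow> real) \<Rightarrow> ('a \<Rightarrow> real) \<Rightarrow> bool" where
  "l2_eq M f g \<longleftrightarrow> (AE x in M. f x = g x)"

text \<open>Unconditional convergence in norm.\<close>

definition l2_has_sum ::
  "'a measure \<Rightarrow> ('i \<Rightarrow> 'a \<Rightarrow> real) \<Rightarrow> 'i set \<Rightarrow> ('a \<Rightarrow> real) \<Rightarrow> bool" where
  "l2_has_sum M h I s \<longleftrightarrow>
     ((\<lambda>F. l2_norm M (\<lambda>x. s x - (\<Sum>i\<in>F. h i x))) \<longlongrightarrow> 0) (finite_subsets_at_top I)"

section \<open>Unbounded operators\<close>

text \<open>An operator is given by its graph, so that its domain is \<^const>\<open>Domain\<close> of the graph.\<close>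

type_synonym 'a l2_graph = "(('a \<Rightarrow> real) \<times> ('a \<Rightarrow> real)) set"

definition l2_operator :: "'a measure \<Rightarrow> 'a l2_graph \<Rightarrow> bool" where
  "l2_operator M T \<longleftrightarrow>
     T \<subseteq> L2 M \<times> L2 M \<and>
     ((\<lambda>_. 0), (\<lambda>_. 0)) \<in> T \<and>
     (\<forall>f u g v a b. (f, u) \<in> T \<longrightarrow> (g, v) \<in> T \<longrightarrow>
        ((\<lambda>x. a * f x + b * g x), (\<lambda>x. a * u x + b * v x)) \<in> T) \<and>
     (\<forall>f u f' u'. (f, u) \<in> T \<longrightarrow> f' \<in> L2 M \<longrightarrow> u' \<in> L2 M \<longrightarrow>
        l2_eq M f f' \<longrightarrow> l2_eq M u u' \<longrightarrow> (f', u') \<in> T) \<and>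
     (\<forall>f u v. (f, u) \<in> T \<longrightarrow> (f, v) \<in> T \<longrightarrow> l2_eq M u v)"

definition l2_dense :: "'a measure \<Rightarrow> ('a \<Rightarrow> real) set \<Rightarrow> bool" where
  "l2_dense M S \<longleftrightarrow> (\<forall>f\<in>L2 M. \<forall>e>0. \<exists>g\<in>S. l2_norm M (\<lambda>x. f x - g x) < e)"

definition l2_adjoint :: "'a measure \<Rightarrow> 'a l2_graph \<Rightarrow> 'a l2_graph" where
  "l2_adjoint M T =
     {(g, v). g \<in> L2 M \<and> v \<in> L2 M \<and> (\<forall>(f, u)\<in>T. l2_inner M u g = l2_inner M f v)}"

definition nonneg_self_adjoint :: "'a measure \<Rightarrow> 'a l2_graph \<Rightarrow> bool" where
  "nonneg_self_adjoint M T \<longleftrightarrow>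
     l2_operator M T \<and> l2_dense M (Domain T) \<and> l2_adjoint M T = T \<and>
     (\<forall>(f, u)\<in>T. 0 \<le> l2_inner M u f)"

text \<open>The relational composition is the graph of the square of \<^term>\<open>S\<close> on its natural domain;
  such an \<^term>\<open>S\<close> is unique.\<close>

definition square_root_of :: "'a measure \<Rightarrow> 'a l2_graph \<Rightarrow> 'a l2_graph \<Rightarrow> bool" where
  "square_root_of M L S \<longleftrightarrow> nonneg_self_adjoint M S \<and> S O S = L"

definition op_app :: "'a l2_graph \<Rightarrow> ('a \<Rightarrow> real) \<Rightarrow> ('a \<Rightarrow> real)" where
  "op_app T f = (SOME u. (f, u) \<in> T)"

section \<open>Spectral projectors and Paley-Wiener spaces\<close>

definition projection_valued_measure ::
  "'a measure \<Rightarrow> (real set \<Rightarrow> ('a \<Rightarrow> real) \<Rightarrow> ('a \<Rightarrow> real)) \<Rightarrow> bool" where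
  "projection_valued_measure M P \<longleftrightarrow>
     (\<forall>A\<in>sets borel. \<forall>f\<in>L2 M.
        P A f \<in> L2 M \<and>
        (\<forall>g\<in>L2 M. l2_eq M f g \<longrightarrow> l2_eq M (P A f) (P A g)) \<and>
        (\<forall>g\<in>L2 M. \<forall>a b. l2_eq M (P A (\<lambda>x. a * f x + b * g x)) (\<lambda>x. a * P A f x + b * P A g x)) \<and>
        (\<forall>g\<in>L2 M. l2_inner M (P A f) g = l2_inner M f (P A g)) \<and>
        (\<forall>B\<in>sets borel. l2_eq M (P A (P B f)) (P (A \<inter> B) f))) \<and>
     (\<forall>f\<in>L2 M. l2_eq M (P UNIV f) f) \<and>
     (\<forall>A::nat \<Rightarrow> real set. range A \<subseteq> sets borel \<longrightarrow> disjoint_family A \<longrightarrow>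
        (\<forall>f\<in>L2 M. (\<lambda>n. l2_norm M (\<lambda>x. P (\<Union>i. A i) f x - (\<Sum>i<n. P (A i) f x)))
                      \<longlonglongrightarrow> 0))"

definition scalar_spectral_measure ::
  "'a measure \<Rightarrow> (real set \<Rightarrow> ('a \<Rightarrow> real) \<Rightarrow> ('a \<Rightarrow> real)) \<Rightarrow> ('a \<Rightarrow> real) \<Rightarrow> real measure" where
  "scalar_spectral_measure M P f =
     measure_of UNIV (sets borel) (\<lambda>A. ennreal (l2_inner M (P A f) f))"

text \<open>\<^term>\<open>T\<close> is the integral of the identity function against \<^term>\<open>P\<close>: its domain consists of
  the vectors whose spectral measure has a finite second moment, and there
  \<open>\<langle>T f, f\<rangle>\<close> is the first moment. For self-adjoint \<^term>\<open>T\<close> the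
  quadratic form determines \<open>\<langle>T f, g\<rangle>\<close> by polarization, and
  \<^term>\<open>P\<close> is unique (up to equality almost everywhere) by the spectral theorem.\<close>

definition spectral_measure_of ::
  "'a measure \<Rightarrow> 'a l2_graph \<Rightarrow> (real set \<Rightarrow> ('a \<Rightarrow> real) \<Rightarrow> ('a \<Rightarrow> real)) \<Rightarrow> bool" where
  "spectral_measure_of M T P \<longleftrightarrow>
     projection_valued_measure M P \<and>
     Domain T = {f \<in> L2 M. integrable (scalar_spectral_measure M P f) (\<lambda>t. t\<^sup>2)} \<and>
     (\<forall>(f, u)\<in>T. l2_inner M u f = (LINT t|scalar_spectral_measure M P f. t))"

text \<open>Here \<^term>\<open>P\<close> is the spectral measure of the square root of the operator, so that
  \<^term>\<open>P {0..\<omega>}\<close> is the characteristic function of \<open>[0, \<omega>]\<close> applied to that square root.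
  As the cut-off is on the square root, the natural sampling distance is of order \<open>\<omega> powr (-1)\<close>;
  the distance \<open>\<omega> powr (-1/2)\<close> is admissible only for \<open>\<omega> \<le> 1\<close>.\<close>

definition paley_wiener ::
  "'a measure \<Rightarrow> (real set \<Rightarrow> ('a \<Rightarrow> real) \<Rightarrow> ('a \<Rightarrow> real)) \<Rightarrow> real \<Rightarrow> ('a \<Rightarrow> real) set" where
  "paley_wiener M P \<omega> = {f \<in> L2 M. \<exists>g\<in>L2 M. l2_eq M f (P {0..\<omega>} g)}"

section \<open>Dirichlet forms\<close>

text \<open>The form associated with an operator with square root \<^term>\<open>S\<close>: it has domain
  \<^term>\<open>Domain S\<close>, and it is the closure of \<open>(f, g) \<mapsto> \<langle>S (S f), g\<rangle>\<close>.\<close>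

definition root_form :: "'a measure \<Rightarrow> 'a l2_graph \<Rightarrow> ('a \<Rightarrow> real) \<Rightarrow> ('a \<Rightarrow> real) \<Rightarrow> real" where
  "root_form M S f g = l2_inner M (op_app S f) (op_app S g)"

type_synonym 'a form = "('a \<Rightarrow> real) \<Rightarrow> ('a \<Rightarrow> real) \<Rightarrow> real"

definition form_norm2 :: "'a measure \<Rightarrow> 'a form \<Rightarrow> ('a \<Rightarrow> real) \<Rightarrow> real" where
  "form_norm2 M E f = E f f + (l2_norm M f)\<^sup>2"

definition dirichlet_form :: "'a measure \<Rightarrow> ('a \<Rightarrow> real) set \<Rightarrow> 'a form \<Rightarrow> bool" where
  "dirichlet_form M \<D> E \<longleftrightarrow>
     \<D> \<subseteq> L2 M \<and> l2_dense M \<D> \<and>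
     (\<forall>f\<in>\<D>. \<forall>g\<in>L2 M. l2_eq M f g \<longrightarrow> g \<in> \<D>) \<and>
     (\<forall>f\<in>\<D>. \<forall>g\<in>\<D>. \<forall>a b. (\<lambda>x. a * f x + b * g x) \<in> \<D> \<and>
        (\<forall>h\<in>\<D>. E (\<lambda>x. a * f x + b * g x) h = a * E f h + b * E g h)) \<and>
     (\<forall>f\<in>\<D>. \<forall>g\<in>\<D>. E f g = E g f) \<and>
     (\<forall>f\<in>\<D>. 0 \<le> E f f) \<and>
     (\<forall>s::nat \<Rightarrow> 'a \<Rightarrow> real. range s \<subseteq> \<D> \<longrightarrow>
        (\<forall>e>0. \<exists>N. \<forall>m\<ge>N. \<forall>n\<ge>N. form_norm2 M E (\<lambda>x. s m x - s n x) < e) \<longrightarrow>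
        (\<exists>f\<in>\<D>. (\<lambda>n. form_norm2 M E (\<lambda>x. s n x - f x)) \<longlonglongrightarrow> 0)) \<and>
     (\<forall>f\<in>\<D>. (\<lambda>x. max 0 (min 1 (f x))) \<in> \<D> \<and>
        E (\<lambda>x. max 0 (min 1 (f x))) (\<lambda>x. max 0 (min 1 (f x))) \<le> E f f)"

definition compactly_supported_cont :: "('a::topological_space \<Rightarrow> real) set" where
  "compactly_supported_cont = {\<phi>. continuous_on UNIV \<phi> \<and> compact (closure {x. \<phi> x \<noteq> 0})}"

definition regular_form :: "'a::metric_space measure \<Rightarrow> ('a \<Rightarrow> real) set \<Rightarrow> 'a form \<Rightarrow> bool" where
  "regular_form M \<D> E \<longleftrightarrow>
     (\<forall>f\<in>\<D>. \<forall>e>0. \<exists>\<phi>\<in>\<D> \<inter> compactly_supported_cont. form_norm2 M E (\<lambda>x. f x - \<phi> x) < e) \<and>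
     (\<forall>\<psi>\<in>compactly_supported_cont. \<forall>e>0.
        \<exists>\<phi>\<in>\<D> \<inter> compactly_supported_cont. \<forall>x. \<bar>\<psi> x - \<phi> x\<bar> < e)"

definition ess_support :: "'a::metric_space measure \<Rightarrow> ('a \<Rightarrow> real) \<Rightarrow> 'a set" where
  "ess_support M f = UNIV - \<Union>{U. open U \<and> (AE x in M. x \<in> U \<longrightarrow> f x = 0)}"

definition strongly_local_form :: "'a::metric_space measure \<Rightarrow> ('a \<Rightarrow> real) set \<Rightarrow> 'a form \<Rightarrow> bool" where
  "strongly_local_form M \<D> E \<longleftrightarrow>
     (\<forall>f\<in>\<D>. \<forall>g\<in>\<D>. compact (ess_support M f) \<longrightarrow> compact (ess_support M g) \<longrightarrow>
        (\<exists>U c. open U \<and> ess_support M g \<subseteq> U \<and> (AE x in M. x \<in> U \<longrightarrow> f x = c)) \<longrightarrow>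
        E f g = 0)"

text \<open>\<^term>\<open>\<Gamma> f\<close> is the diagonal energy measure \<open>d\<Gamma>(f, f)\<close>; the off-diagonal ones are obtained
  from it by polarization. For bounded \<^term>\<open>f\<close> it is given by the usual formula, normalized so
  that its total mass is \<^term>\<open>E f f\<close>, and for general \<^term>\<open>f\<close> by truncation. These
  conditions determine \<^term>\<open>\<Gamma>\<close> on \<^term>\<open>\<D>\<close>.\<close>

definition energy_measure ::
  "'a::metric_space measure \<Rightarrow> ('a \<Rightarrow> real) set \<Rightarrow> 'a form \<Rightarrow> (('a \<Rightarrow> real) \<Rightarrow> 'a measure) \<Rightarrow> bool" where
  "energy_measure M \<D> E \<Gamma> \<longleftrightarrow>
     (\<forall>f\<in>\<D>. sets (\<Gamma> f) = sets borel \<and> emeasure (\<Gamma> f) UNIV = ennreal (E f f)) \<and>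
     (\<forall>f\<in>\<D>. (\<exists>c. AE x in M. \<bar>f x\<bar> \<le> c) \<longrightarrow>
        (\<forall>\<phi>\<in>\<D> \<inter> compactly_supported_cont.
           (LINT x|\<Gamma> f. \<phi> x) = E (\<lambda>x. \<phi> x * f x) f - E (\<lambda>x. (f x)\<^sup>2) \<phi> / 2)) \<and>
     (\<forall>f\<in>\<D>. \<forall>A\<in>sets borel.
        (\<lambda>n. measure (\<Gamma> (\<lambda>x. max (- real n) (min (real n) (f x)))) A) \<longlonglongrightarrow> measure (\<Gamma> f) A)"

section \<open>Poincare inequality and metric lattices\<close>

definition ball_average :: "'a::metric_space measure \<Rightarrow> ('a \<Rightarrow> real) \<Rightarrow> 'a \<Rightarrow> real \<Rightarrow> real" where
  "ball_average M f x r = (LINT y:ball x r|M. f y) / measure M (ball x r)"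

definition local_poincare ::
  "'a::metric_space measure \<Rightarrow> 'a l2_graph \<Rightarrow> (('a \<Rightarrow> real) \<Rightarrow> 'a measure) \<Rightarrow> real \<Rightarrow> real \<Rightarrow> bool" where
  "local_poincare M L \<Gamma> C r\<^sub>0 \<longleftrightarrow>
     (\<forall>f\<in>Domain L. \<forall>x r. 0 < r \<longrightarrow> r \<le> r\<^sub>0 \<longrightarrow>
        (LINT y:ball x r|M. (f y - ball_average M f x r)\<^sup>2) \<le> C * r\<^sup>2 * measure (\<Gamma> f) (ball x r))"

definition metric_lattice :: "nat \<Rightarrow> real \<Rightarrow> 'a::metric_space set \<Rightarrow> bool" where
  "metric_lattice N \<rho> X \<longleftrightarrow>
     (\<forall>x\<in>X. \<forall>y\<in>X. x \<noteq> y \<longrightarrow> ball x (\<rho> / 2) \<inter> ball y (\<rho> / 2) = {}) \<and>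
     (\<Union>x\<in>X. ball x \<rho>) = UNIV \<and>
     (\<forall>y. finite {x\<in>X. y \<in> ball x \<rho>} \<and> card {x\<in>X. y \<in> ball x \<rho>} \<le> N)"

definition xi :: "'a::metric_space measure \<Rightarrow> real \<Rightarrow> 'a \<Rightarrow> 'a \<Rightarrow> real" where
  "xi M \<rho> x = (\<lambda>y. measure M (ball x \<rho>) powr (-1/2) * indicator (ball x \<rho>) y)"

section \<open>Frames in a closed subspace of the Hilbert space\<close>

definition frame_bounds ::
  "'a measure \<Rightarrow> ('a \<Rightarrow> real) set \<Rightarrow> 'i set \<Rightarrow> ('i \<Rightarrow> 'a \<Rightarrow> real) \<Rightarrow> real \<Rightarrow> real \<Rightarrow> bool" where
  "frame_bounds M H I \<theta> a b \<longleftrightarrow>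
     0 < a \<and> a \<le> b \<and> (\<forall>i\<in>I. \<theta> i \<in> H) \<and>
     (\<forall>f\<in>H. (\<lambda>i. (l2_inner M f (\<theta> i))\<^sup>2) summable_on I \<and>
        a * (l2_norm M f)\<^sup>2 \<le> (\<Sum>\<^sub>\<infinity>i\<in>I. (l2_inner M f (\<theta> i))\<^sup>2) \<and>
        (\<Sum>\<^sub>\<infinity>i\<in>I. (l2_inner M f (\<theta> i))\<^sup>2) \<le> b * (l2_norm M f)\<^sup>2)"

definition l2_frame ::
  "'a measure \<Rightarrow> ('a \<Rightarrow> real) set \<Rightarrow> 'i set \<Rightarrow> ('i \<Rightarrow> 'a \<Rightarrow> real) \<Rightarrow> bool" where
  "l2_frame M H I \<theta> \<longleftrightarrow> (\<exists>a b. frame_bounds M H I \<theta> a b)"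

definition dual_frame ::
  "'a measure \<Rightarrow> ('a \<Rightarrow> real) set \<Rightarrow> 'i set \<Rightarrow> ('i \<Rightarrow> 'a \<Rightarrow> real) \<Rightarrow> ('i \<Rightarrow> 'a \<Rightarrow> real) \<Rightarrow> bool" where
  "dual_frame M H I \<theta> \<Theta> \<longleftrightarrow>
     l2_frame M H I \<Theta> \<and>
     (\<forall>f\<in>H. l2_has_sum M (\<lambda>i x. l2_inner M f (\<theta> i) * \<Theta> i x) I f)"

definition frame_operator ::
  "'a measure \<Rightarrow> ('a \<Rightarrow> real) set \<Rightarrow> 'i set \<Rightarrow> ('i \<Rightarrow> 'a \<Rightarrow> real) \<Rightarrow> ('a \<Rightarrow> real) \<Rightarrow> ('a \<Rightarrow> real)" where
  "frame_operator M H I \<theta> f =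
     (SOME g. g \<in> H \<and> l2_has_sum M (\<lambda>i x. l2_inner M f (\<theta> i) * \<theta> i x) I g)"

primrec frame_iter ::
  "'a measure \<Rightarrow> ('a \<Rightarrow> real) set \<Rightarrow> 'i set \<Rightarrow> ('i \<Rightarrow> 'a \<Rightarrow> real) \<Rightarrow> real \<Rightarrow> ('a \<Rightarrow> real) \<Rightarrow> nat
     \<Rightarrow> ('a \<Rightarrow> real)" where
  "frame_iter M H I \<theta> \<tau> f 0 = (\<lambda>x. 0)"
| "frame_iter M H I \<theta> \<tau> f (Suc n) =
     (\<lambda>x. frame_iter M H I \<theta> \<tau> f n x
        + \<tau> * frame_operator M H I \<theta> (\<lambda>y. f y - frame_iter M H I \<theta> \<tau> f n y) x)"

text \<open>The frame algorithm with frame bounds \<^term>\<open>a\<close>, \<^term>\<open>b\<close>. The first conjunct says that the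
  series defining the frame operator converges, so that the choice in
  \<^const>\<open>frame_operator\<close> is not arbitrary.\<close>

definition frame_algorithm_converges ::
  "'a measure \<Rightarrow> ('a \<Rightarrow> real) set \<Rightarrow> 'i set \<Rightarrow> ('i \<Rightarrow> 'a \<Rightarrow> real) \<Rightarrow> real \<Rightarrow> real \<Rightarrow> bool" where
  "frame_algorithm_converges M H I \<theta> a b \<longleftrightarrow>
     (\<forall>f\<in>H. frame_operator M H I \<theta> f \<in> H \<and>
        l2_has_sum M (\<lambda>i x. l2_inner M f (\<theta> i) * \<theta> i x) I (frame_operator M H I \<theta> f)) \<and>
     (\<forall>\<tau>. 0 < \<tau> \<longrightarrow> \<tau> < 2 / b \<longrightarrow>
        (let \<eta> = max \<bar>1 - \<tau> * a\<bar> \<bar>1 - \<tau> * b\<bar> in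
           \<eta> < 1 \<and>
           (\<tau> = 2 / (a + b) \<longrightarrow> \<eta> = (b - a) / (a + b)) \<and>
           (\<forall>f\<in>H. (\<forall>n. l2_norm M (\<lambda>x. f x - frame_iter M H I \<theta> \<tau> f n x) \<le> \<eta> ^ n * l2_norm M f) \<and>
              (\<lambda>n. l2_norm M (\<lambda>x. f x - frame_iter M H I \<theta> \<tau> f n x)) \<longlonglongrightarrow> 0)))"

end

theory Submission
  imports Defs
begin

text \<open>On \<open>PW\<^sub>\<omega>\<close> the Bernstein inequality \<open>\<parallel>\<surd>L f\<parallel> \<le> \<omega> \<parallel>f\<parallel>\<close> holds. Splitting the mass of \<open>f\<close> on each lattice
  ball into variance and squared average, and summing the local Poincare inequality over the balls,
  which overlap at most \<open>N\<close> times, gives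
  \<open>\<parallel>f\<parallel>\<^sup>2 \<le> C N \<rho>\<^sup>2 \<parallel>\<surd>L f\<parallel>\<^sup>2 + \<Sum>\<^sub>j \<langle>f, \<xi>\<^sub>j\<rangle>\<^sup>2\<close>. Both admissible choices of \<open>\<rho>\<close> satisfy \<open>\<rho> \<omega> \<le> \<nu>\<close>, so
  that for small \<open>\<nu>\<close> the first summand is at most \<open>\<parallel>f\<parallel>\<^sup>2 / 2\<close> and the projections of the \<open>\<xi>\<^sub>j\<close> form a frame
  of \<open>PW\<^sub>\<omega>\<close>. Reconstruction and the frame algorithm are then general facts about the frame operator,
  whose relaxation \<open>1 - \<tau> \<Phi>\<close> is a contraction.\<close>

section \<open>Square integrable functions\<close>

text \<open>Vectors are functions, so \<open>\<Phi>\<close> and \<open>op_app S\<close> are choices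
  of representatives and are linear only up to null functions. Identities between vectors are
  therefore proved weakly, by pairing with elements of the space, and norm bounds are read off from
  the quadratic forms of symmetric maps. The spectral measure \<open>P\<close> is tied to
  \<open>S\<close> only through the domain of \<open>S\<close> and the first moment that gives the
  form of \<open>S\<close> at \<open>f\<close>; nothing is said about the norm of
  \<open>S f\<close>. Bernstein's inequality thus first needs that \<open>S\<close> maps the
  Paley-Wiener space into itself: then \<open>S\<close> is a symmetric map of this space with form
  between 0 and \<open>\<omega>\<close>, and the general norm bound applies. The same invariance
  places the space inside the domain of \<open>L = S O S\<close>, on which the Poincare inequality
  is assumed. The \<open>xi\<close> need not lie in the Paley-Wiener space, hence the projections;
  pairings with band-limited functions do not change.\<close>

lemma L2_measurable [measurable_dest]: "f \<in> L2 M \<Longrightarrow> f \<in> borel_measurable M"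
  by (simp add: L2_def)

lemma L2_integrable_mult:
  assumes "f \<in> L2 M" "g \<in> L2 M"
  shows "integrable M (\<lambda>x. f x * g x)"
proof (rule Bochner_Integration.integrable_bound)
  show "integrable M (\<lambda>x. (f x)\<^sup>2 + (g x)\<^sup>2)"
    using assms by (simp add: L2_def)
  show "(\<lambda>x. f x * g x) \<in> borel_measurable M"
    using assms by (auto simp: L2_def)
  have "\<bar>u * v\<bar> \<le> u\<^sup>2 + v\<^sup>2" for u v :: real
  proof -
    have "2 * \<bar>u * v\<bar> \<le> u\<^sup>2 + v\<^sup>2"
      using sum_squares_bound[of "\<bar>u\<bar>" "\<bar>v\<bar>"] by (simp add: abs_mult mult.assoc)
    then show ?thesis
      using abs_ge_zero[of "u * v"] by linarith
  qed
  then show "AE x in M. norm (f x * g x) \<le> norm ((f x)\<^sup>2 + (g x)\<^sup>2)"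
    by simp
qed

lemma L2_lincomb:
  assumes "f \<in> L2 M" "g \<in> L2 M"
  shows "(\<lambda>x. a * f x + b * g x) \<in> L2 M"
proof -
  have "integrable M (\<lambda>x. a\<^sup>2 * (f x)\<^sup>2 + 2 * a * b * (f x * g x) + b\<^sup>2 * (g x)\<^sup>2)"
    using assms L2_integrable_mult[OF assms] by (simp add: L2_def)
  then show ?thesis
    using assms unfolding L2_def by (auto simp: power2_sum power_mult_distrib algebra_simps)
qed

lemma L2_zero [simp]: "(\<lambda>x. 0) \<in> L2 M"
  by (simp add: L2_def)

lemma L2_add [simp]: "f \<in> L2 M \<Longrightarrow> g \<in> L2 M \<Longrightarrow> (\<lambda>x. f x + g x) \<in> L2 M"
  using L2_lincomb[of f M g 1 1] by simp

lemma L2_diff [simp]: "f \<in> L2 M \<Longrightarrow> g \<in> L2 M \<Longrightarrow> (\<lambda>x. f x - g x) \<in> L2 M"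
  using L2_lincomb[of f M g 1 "-1"] by simp

lemma L2_scale [simp]: "f \<in> L2 M \<Longrightarrow> (\<lambda>x. c * f x) \<in> L2 M"
  using L2_lincomb[of f M f c 0] by simp

lemma L2_sum [simp]: "(\<And>i. i \<in> F \<Longrightarrow> h i \<in> L2 M) \<Longrightarrow> (\<lambda>x. \<Sum>i\<in>F. h i x) \<in> L2 M"
  by (induction F rule: infinite_finite_induct) auto

section \<open>Inner product and seminorm\<close>

lemma l2_inner_commute: "l2_inner M f g = l2_inner M g f"
  by (simp add: l2_inner_def mult.commute)

lemma l2_inner_zero_left [simp]: "l2_inner M (\<lambda>x. 0) f = 0"
  by (simp add: l2_inner_def)

lemma l2_inner_add_left [simp]:
  "f \<in> L2 M \<Longrightarrow> g \<in> L2 M \<Longrightarrow> h \<in> L2 M \<Longrightarrow>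
    l2_inner M (\<lambda>x. f x + g x) h = l2_inner M f h + l2_inner M g h"
  by (simp add: l2_inner_def distrib_right L2_integrable_mult)

lemma l2_inner_diff_left [simp]:
  "f \<in> L2 M \<Longrightarrow> g \<in> L2 M \<Longrightarrow> h \<in> L2 M \<Longrightarrow>
    l2_inner M (\<lambda>x. f x - g x) h = l2_inner M f h - l2_inner M g h"
  by (simp add: l2_inner_def left_diff_distrib L2_integrable_mult)

lemma l2_inner_scale_left [simp]: "l2_inner M (\<lambda>x. c * f x) h = c * l2_inner M f h"
  by (simp add: l2_inner_def mult.assoc)

lemma l2_inner_add_right [simp]:
  "f \<in> L2 M \<Longrightarrow> g \<in> L2 M \<Longrightarrow> h \<in> L2 M \<Longrightarrow>
    l2_inner M h (\<lambda>x. f x + g x) = l2_inner M h f + l2_inner M h g"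
  by (subst (1 2 3) l2_inner_commute) simp

lemma l2_inner_diff_right [simp]:
  "f \<in> L2 M \<Longrightarrow> g \<in> L2 M \<Longrightarrow> h \<in> L2 M \<Longrightarrow>
    l2_inner M h (\<lambda>x. f x - g x) = l2_inner M h f - l2_inner M h g"
  by (subst (1 2 3) l2_inner_commute) simp

lemma l2_inner_scale_right [simp]: "l2_inner M h (\<lambda>x. c * f x) = c * l2_inner M h f"
  by (subst (1 2) l2_inner_commute) simp

lemma l2_inner_sum_left:
  "(\<And>i. i \<in> F \<Longrightarrow> h i \<in> L2 M) \<Longrightarrow> k \<in> L2 M \<Longrightarrow>
    l2_inner M (\<lambda>x. \<Sum>i\<in>F. h i x) k = (\<Sum>i\<in>F. l2_inner M (h i) k)"
  by (induction F rule: infinite_finite_induct) auto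

lemma l2_inner_self_nonneg [simp]: "0 \<le> l2_inner M f f"
  by (simp add: l2_inner_def)

lemma l2_norm_power2: "(l2_norm M f)\<^sup>2 = l2_inner M f f"
  by (simp add: l2_norm_def)

lemma l2_norm_nonneg [simp]: "0 \<le> l2_norm M f"
  by (simp add: l2_norm_def)

lemma l2_norm_zero [simp]: "l2_norm M (\<lambda>x. 0) = 0"
  by (simp add: l2_norm_def)

text \<open>For positive \<open>c\<close> evaluate at the minimiser \<open>b / c\<close>. The case
  \<open>c = 0\<close> must be covered because \<open>l2_inner\<close> is only semidefinite on
  functions.\<close>

lemma quadratic_nonneg_discriminant:
  fixes a b c :: real
  assumes nonneg: "\<And>t. 0 \<le> a - 2 * t * b + t\<^sup>2 * c" and "0 \<le> c"
  shows "b\<^sup>2 \<le> a * c"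
proof (cases "c = 0")
  case True
  have "b = 0"
  proof (rule ccontr)
    assume "b \<noteq> 0"
    \<comment> \<open>For \<open>c = 0\<close> this choice of \<open>t\<close> makes the affine
      function equal to -1.\<close>
    then show False
      using nonneg[of "(a + 1) / (2 * b)"] True by simp
  qed
  then show ?thesis
    using True by simp
next
  case False
  with \<open>0 \<le> c\<close> have "0 < c" by simp
  then show ?thesis
    using nonneg[of "b / c"] by (simp add: power2_eq_square field_simps)
qed

lemma l2_cauchy_schwarz:
  assumes "f \<in> L2 M" "g \<in> L2 M"
  shows "\<bar>l2_inner M f g\<bar> \<le> l2_norm M f * l2_norm M g"
proof -
  have "0 \<le> l2_inner M f f - 2 * t * l2_inner M f g + t\<^sup>2 * l2_inner M g g" for t
    using l2_inner_self_nonneg[of M "\<lambda>x. f x - t * g x"] assms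
    by (simp add: l2_inner_commute[of M g f] power2_eq_square algebra_simps)
  then have "(l2_inner M f g)\<^sup>2 \<le> l2_inner M f f * l2_inner M g g"
    by (intro quadratic_nonneg_discriminant) auto
  then have "(l2_inner M f g)\<^sup>2 \<le> (l2_norm M f * l2_norm M g)\<^sup>2"
    by (simp add: power_mult_distrib l2_norm_power2)
  then show ?thesis
    by (metis abs_le_square_iff abs_of_nonneg l2_norm_nonneg mult_nonneg_nonneg)
qed

lemma l2_norm_triangle:
  assumes "f \<in> L2 M" "g \<in> L2 M"
  shows "l2_norm M (\<lambda>x. f x + g x) \<le> l2_norm M f + l2_norm M g"
proof (rule power2_le_imp_le)
  show "(l2_norm M (\<lambda>x. f x + g x))\<^sup>2 \<le> (l2_norm M f + l2_norm M g)\<^sup>2"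
    using l2_cauchy_schwarz[OF assms] assms
    by (simp add: power2_sum l2_norm_power2 l2_inner_commute[of M g f])
qed simp

lemma l2_norm_scale: "l2_norm M (\<lambda>x. c * f x) = \<bar>c\<bar> * l2_norm M f"
proof -
  have "l2_inner M (\<lambda>x. c * f x) (\<lambda>x. c * f x) = c\<^sup>2 * l2_inner M f f"
    by (simp add: power2_eq_square)
  then show ?thesis
    by (simp only: l2_norm_def real_sqrt_mult real_sqrt_abs)
qed

lemma l2_norm_diff_commute: "l2_norm M (\<lambda>x. f x - g x) = l2_norm M (\<lambda>x. g x - f x)"
  using l2_norm_scale[of M "-1" "\<lambda>x. f x - g x"] by simp

lemma l2_norm_triangle_diff:
  assumes "f \<in> L2 M" "g \<in> L2 M" "h \<in> L2 M"
  shows "l2_norm M (\<lambda>x. f x - h x) \<le> l2_norm M (\<lambda>x. f x - g x) + l2_norm M (\<lambda>x. g x - h x)"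
  using l2_norm_triangle[of "\<lambda>x. f x - g x" M "\<lambda>x. g x - h x"] assms by simp

lemma l2_norm_eq_0_iff:
  assumes "f \<in> L2 M"
  shows "l2_norm M f = 0 \<longleftrightarrow> (AE x in M. f x = 0)"
proof -
  have "integral\<^sup>L M (\<lambda>x. f x * f x) = 0 \<longleftrightarrow> (AE x in M. f x * f x = 0)"
    using assms by (intro integral_nonneg_eq_0_iff_AE L2_integrable_mult) auto
  then show ?thesis
    by (simp add: l2_norm_def l2_inner_def)
qed

lemma l2_eq_iff_norm:
  assumes "f \<in> L2 M" "g \<in> L2 M"
  shows "l2_eq M f g \<longleftrightarrow> l2_norm M (\<lambda>x. f x - g x) = 0"
  using assms by (simp add: l2_norm_eq_0_iff l2_eq_def)

lemma l2_inner_null_left: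
  assumes "f \<in> L2 M" "g \<in> L2 M" "l2_norm M f = 0"
  shows "l2_inner M f g = 0"
  using l2_cauchy_schwarz[OF assms(1,2)] assms(3) by simp

lemma l2_inner_cong_left:
  assumes "f \<in> L2 M" "f' \<in> L2 M" "g \<in> L2 M" "l2_eq M f f'"
  shows "l2_inner M f g = l2_inner M f' g"
  using l2_inner_null_left[of "\<lambda>x. f x - f' x" M g] assms by (simp add: l2_eq_iff_norm)

section \<open>Series converging in norm\<close>

lemma l2_has_sum_cong_null:
  assumes "l2_has_sum M h I s" "s \<in> L2 M" "s' \<in> L2 M" "l2_norm M (\<lambda>x. s' x - s x) = 0"
    and "\<And>i. i \<in> I \<Longrightarrow> h i \<in> L2 M"
  shows "l2_has_sum M h I s'"
  unfolding l2_has_sum_def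
proof (rule Lim_null_comparison)
  show "((\<lambda>F. l2_norm M (\<lambda>x. s x - (\<Sum>i\<in>F. h i x))) \<longlongrightarrow> 0) (finite_subsets_at_top I)"
    using assms(1) by (simp add: l2_has_sum_def)
  show "\<forall>\<^sub>F F in finite_subsets_at_top I. norm (l2_norm M (\<lambda>x. s' x - (\<Sum>i\<in>F. h i x)))
      \<le> l2_norm M (\<lambda>x. s x - (\<Sum>i\<in>F. h i x))"
  proof (rule eventually_finite_subsets_at_top_weakI)
    fix F assume "finite F" "F \<subseteq> I"
    then have "(\<lambda>x. \<Sum>i\<in>F. h i x) \<in> L2 M"
      using assms(5) by (intro L2_sum) auto
    from l2_norm_triangle_diff[OF assms(3,2) this] assms(4)
    show "norm (l2_norm M (\<lambda>x. s' x - (\<Sum>i\<in>F. h i x))) \<le> l2_norm M (\<lambda>x. s x - (\<Sum>i\<in>F. h i x))"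
      by simp
  qed
qed

text \<open>Norm convergence implies weak convergence by Cauchy-Schwarz. This reduces identities
  between vector series to identities between real series.\<close>

lemma l2_has_sum_inner:
  assumes "l2_has_sum M h I s" "s \<in> L2 M" "k \<in> L2 M" "\<And>i. i \<in> I \<Longrightarrow> h i \<in> L2 M"
  shows "((\<lambda>i. l2_inner M (h i) k) has_sum l2_inner M s k) I"
  unfolding has_sum_def
proof (rule LIM_zero_cancel)
  show "((\<lambda>F. (\<Sum>i\<in>F. l2_inner M (h i) k) - l2_inner M s k) \<longlongrightarrow> 0) (finite_subsets_at_top I)"
  proof (rule Lim_null_comparison)
    show "((\<lambda>F. l2_norm M (\<lambda>x. s x - (\<Sum>i\<in>F. h i x)) * l2_norm M k) \<longlongrightarrow> 0)
        (finite_subsets_at_top I)"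
      using assms(1) unfolding l2_has_sum_def by (rule tendsto_mult_left_zero)
    show "\<forall>\<^sub>F F in finite_subsets_at_top I. norm ((\<Sum>i\<in>F. l2_inner M (h i) k) - l2_inner M s k)
        \<le> l2_norm M (\<lambda>x. s x - (\<Sum>i\<in>F. h i x)) * l2_norm M k"
    proof (rule eventually_finite_subsets_at_top_weakI)
      fix F assume "finite F" "F \<subseteq> I"
      then have h: "\<And>i. i \<in> F \<Longrightarrow> h i \<in> L2 M"
        using assms(4) by auto
      have "l2_inner M (\<lambda>x. s x - (\<Sum>i\<in>F. h i x)) k = l2_inner M s k - (\<Sum>i\<in>F. l2_inner M (h i) k)"
        using assms(2,3) h by (simp add: l2_inner_sum_left)
      then show "norm ((\<Sum>i\<in>F. l2_inner M (h i) k) - l2_inner M s k)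
          \<le> l2_norm M (\<lambda>x. s x - (\<Sum>i\<in>F. h i x)) * l2_norm M k"
        using l2_cauchy_schwarz[of "\<lambda>x. s x - (\<Sum>i\<in>F. h i x)" M k] assms(2,3) h
        by (simp add: abs_minus_commute)
    qed
  qed
qed

section \<open>Frames in a complete space of square integrable functions\<close>

locale l2_subspace =
  fixes M :: "'a measure" and H :: "('a \<Rightarrow> real) set"
  assumes in_L2 [simp]: "f \<in> H \<Longrightarrow> f \<in> L2 M"
    and zero_in [simp]: "(\<lambda>x. 0) \<in> H"
    and lincomb_in: "f \<in> H \<Longrightarrow> g \<in> H \<Longrightarrow> (\<lambda>x. a * f x + b * g x) \<in> H"
begin

lemma add_in [simp]: "f \<in> H \<Longrightarrow> g \<in> H \<Longrightarrow> (\<lambda>x. f x + g x) \<in> H"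
  using lincomb_in[of f g 1 1] by simp

lemma diff_in [simp]: "f \<in> H \<Longrightarrow> g \<in> H \<Longrightarrow> (\<lambda>x. f x - g x) \<in> H"
  using lincomb_in[of f g 1 "-1"] by simp

lemma scale_in [simp]: "f \<in> H \<Longrightarrow> (\<lambda>x. c * f x) \<in> H"
  using lincomb_in[of f f c 0] by simp

lemma sum_in [simp]: "(\<And>i. i \<in> F \<Longrightarrow> h i \<in> H) \<Longrightarrow> (\<lambda>x. \<Sum>i\<in>F. h i x) \<in> H"
  by (induction F rule: infinite_finite_induct) auto

lemma norm_eq_0_if_orthogonal:
  assumes "u \<in> H" "\<And>k. k \<in> H \<Longrightarrow> l2_inner M u k = 0"
  shows "l2_norm M u = 0"
  using assms by (simp add: l2_norm_def)

lemma norm_eq_if_inner_eq: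
  assumes "u \<in> H" "v \<in> H" "\<And>k. k \<in> H \<Longrightarrow> l2_inner M u k = l2_inner M v k"
  shows "l2_norm M u = l2_norm M v"
  using assms by (metis l2_inner_commute l2_norm_def)

text \<open>Symmetry forces linearity up to null functions, so it need not be assumed.\<close>

lemma symmetric_operator_norm_le:
  assumes R: "\<And>f. f \<in> H \<Longrightarrow> R f \<in> H"
    and sym: "\<And>f g. f \<in> H \<Longrightarrow> g \<in> H \<Longrightarrow> l2_inner M (R f) g = l2_inner M f (R g)"
    and form: "\<And>f. f \<in> H \<Longrightarrow> \<bar>l2_inner M (R f) f\<bar> \<le> \<eta> * (l2_norm M f)\<^sup>2"
    and "0 \<le> \<eta>" and f: "f \<in> H"
  shows "l2_norm M (R f) \<le> \<eta> * l2_norm M f"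
proof -
  define F G where "F = l2_norm M f" and "G = l2_norm M (R f)"
  have nonneg: "0 \<le> F" "0 \<le> G"
    by (auto simp: F_def G_def)
  \<comment> \<open>Polarization with \<open>g = t * R f\<close>: the difference of the forms at
    \<open>f + g\<close> and \<open>f - g\<close> is \<open>4 * t * G\<^sup>2\<close>, and the
    parallelogram law sums the two bounds. In \<open>plus\<close> and \<open>minus\<close>,
    \<open>R\<close> is moved to the other factor before anything is expanded, so
    \<open>R (f + g)\<close> is never split.\<close>
  have main: "2 * t * G\<^sup>2 \<le> \<eta> * (F\<^sup>2 + t\<^sup>2 * G\<^sup>2)" for t
  proof -
    define g where "g = (\<lambda>x. t * R f x)"
    have g: "g \<in> H"
      using f R by (simp add: g_def)
    have Rg: "l2_inner M (R h) g = l2_inner M h (R g)" if "h \<in> H" for h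
      using sym that g by blast
    have gRf: "l2_inner M g (R f) = t * G\<^sup>2"
      by (simp add: g_def G_def l2_norm_power2)
    have fRg: "l2_inner M f (R g) = t * G\<^sup>2"
      using sym[OF f g] gRf by (simp add: l2_inner_commute)
    have gg: "(l2_norm M g)\<^sup>2 = t\<^sup>2 * G\<^sup>2"
      by (simp add: g_def G_def l2_norm_scale power_mult_distrib)
    have plus: "l2_inner M (R (\<lambda>x. f x + g x)) (\<lambda>x. f x + g x)
        = l2_inner M f (R f) + 2 * (t * G\<^sup>2) + l2_inner M g (R g)"
      using sym[of "\<lambda>x. f x + g x" f] sym[of "\<lambda>x. f x + g x" g] f g R[of f] R[of g] fRg gRf
        R[of "\<lambda>x. f x + g x"] by simp
    have minus: "l2_inner M (R (\<lambda>x. f x - g x)) (\<lambda>x. f x - g x)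
        = l2_inner M f (R f) - 2 * (t * G\<^sup>2) + l2_inner M g (R g)"
      using sym[of "\<lambda>x. f x - g x" f] sym[of "\<lambda>x. f x - g x" g] f g R[of f] R[of g] fRg gRf
        R[of "\<lambda>x. f x - g x"] by simp
    have par: "(l2_norm M (\<lambda>x. f x + g x))\<^sup>2 + (l2_norm M (\<lambda>x. f x - g x))\<^sup>2
        = 2 * (F\<^sup>2 + t\<^sup>2 * G\<^sup>2)"
      using f g gg by (simp add: F_def l2_norm_power2 l2_inner_commute[of M g f])
    have "4 * (t * G\<^sup>2) \<le> \<eta> * (l2_norm M (\<lambda>x. f x + g x))\<^sup>2 + \<eta> * (l2_norm M (\<lambda>x. f x - g x))\<^sup>2"
      using form[of "\<lambda>x. f x + g x"] form[of "\<lambda>x. f x - g x"] f g plus minus by simp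
    also have "\<dots> = 2 * (\<eta> * (F\<^sup>2 + t\<^sup>2 * G\<^sup>2))"
      using par by (metis distrib_left mult.left_commute)
    finally show ?thesis by simp
  qed
  have "G \<le> \<eta> * F"
  proof (cases "G = 0")
    case True
    then show ?thesis
      using nonneg \<open>0 \<le> \<eta>\<close> by simp
  next
    case False
    with nonneg have "0 < G" by simp
    show ?thesis
    proof (cases "F = 0")
      case True
      \<comment> \<open>A null \<open>f\<close> must have a null image although \<open>R\<close> is
        not assumed to respect almost everywhere equality. With \<open>F = 0\<close> and
        \<open>\<eta> * r \<le> 1\<close> the inequality becomes
        \<open>2 * r * G\<^sup>2 \<le> r * G\<^sup>2\<close>, against \<open>0 < G\<close>.\<close>
      define r where "r = 1 / (\<eta> + 1)"
      have "0 < r" "\<eta> * r \<le> 1"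
        using \<open>0 \<le> \<eta>\<close> by (auto simp: r_def)
      have "2 * (r * G\<^sup>2) \<le> (\<eta> * r) * (r * G\<^sup>2)"
        using main[of r] True by (simp add: power2_eq_square mult_ac)
      also have "\<dots> \<le> 1 * (r * G\<^sup>2)"
        using \<open>\<eta> * r \<le> 1\<close> \<open>0 < r\<close> by (intro mult_right_mono) auto
      finally show ?thesis
        using \<open>0 < r\<close> \<open>0 < G\<close> by simp
    next
      case False
      with nonneg have "0 < F" by simp
      \<comment> \<open>The value \<open>t = F / G\<close> makes \<open>f\<close> and
        \<open>t * R f\<close> equally long and balances the two sides of
        \<open>main\<close>.\<close>
      have "2 * F * G \<le> \<eta> * (2 * F\<^sup>2)"
        using main[of "F / G"] \<open>0 < G\<close> by (simp add: power2_eq_square field_simps)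
      then show ?thesis
        using \<open>0 < F\<close> by (simp add: power2_eq_square)
    qed
  qed
  then show ?thesis
    by (simp add: F_def G_def)
qed

end

text \<open>Completeness is required of \<open>H\<close> itself and only for sequences. For
  Paley-Wiener spaces it comes from the closedness of the Dirichlet form.\<close>

locale l2_hilbert = l2_subspace +
  assumes complete: "range s \<subseteq> H \<Longrightarrow>
      (\<And>e. e > 0 \<Longrightarrow> \<exists>N. \<forall>m\<ge>N. \<forall>n\<ge>N. l2_norm M (\<lambda>x. s m x - s n x) < e) \<Longrightarrow>
      \<exists>f\<in>H. (\<lambda>n. l2_norm M (\<lambda>x. s n x - f x)) \<longlonglongrightarrow> 0"
begin

lemma geometric_sequence_converges:
  assumes s: "\<And>n. s n \<in> H" and "0 \<le> c" "0 \<le> \<eta>" "\<eta> < 1"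
    and step: "\<And>n. l2_norm M (\<lambda>x. s (Suc n) x - s n x) \<le> c * \<eta> ^ n"
  shows "\<exists>f\<in>H. (\<lambda>n. l2_norm M (\<lambda>x. s n x - f x)) \<longlonglongrightarrow> 0"
proof (rule complete)
  show "range s \<subseteq> H"
    using s by auto
  \<comment> \<open>The geometric series bound: \<open>C\<close> is chosen so that
    \<open>c * \<eta> ^ n\<close> is the difference of consecutive \<open>C * \<eta> ^ n\<close>,
    which makes the distances telescope.\<close>
  define C where "C = c / (1 - \<eta>)"
  have "0 \<le> C"
    using assms by (simp add: C_def)
  have C: "C * \<eta> ^ n - C * \<eta> ^ Suc n = c * \<eta> ^ n" for n
  proof -
    have "C * \<eta> ^ n - C * \<eta> ^ Suc n = (C * (1 - \<eta>)) * \<eta> ^ n"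
      by (simp add: algebra_simps)
    then show ?thesis
      using \<open>\<eta> < 1\<close> by (simp add: C_def)
  qed
  have far: "l2_norm M (\<lambda>x. s (n + k) x - s n x) \<le> C * \<eta> ^ n - C * \<eta> ^ (n + k)" for n k
  proof (induction k)
    case (Suc k)
    have "l2_norm M (\<lambda>x. s (n + Suc k) x - s n x) \<le>
        l2_norm M (\<lambda>x. s (Suc (n + k)) x - s (n + k) x) + l2_norm M (\<lambda>x. s (n + k) x - s n x)"
      using l2_norm_triangle_diff[of "s (n + Suc k)" M "s (n + k)" "s n"] s by simp
    then show ?case
      using Suc step[of "n + k"] C[of "n + k"] by simp
  qed simp
  have near: "l2_norm M (\<lambda>x. s m x - s n x) \<le> C * \<eta> ^ n" if "n \<le> m" for m n
    using far[of n "m - n"] that \<open>0 \<le> C\<close> \<open>0 \<le> \<eta>\<close>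
    by simp (smt (verit) mult_nonneg_nonneg zero_le_power)
  fix e :: real assume "0 < e"
  have "(\<lambda>n. C * \<eta> ^ n) \<longlonglongrightarrow> 0"
    using assms by (intro tendsto_mult_right_zero LIMSEQ_realpow_zero) auto
  then have "\<forall>\<^sub>F n in sequentially. C * \<eta> ^ n < e"
    using \<open>0 < e\<close> by (rule order_tendstoD)
  then obtain N where N: "\<And>n. n \<ge> N \<Longrightarrow> C * \<eta> ^ n < e"
    by (auto simp: eventually_sequentially)
  have "l2_norm M (\<lambda>x. s m x - s n x) < e" if "N \<le> m" "N \<le> n" for m n
  proof (cases "n \<le> m")
    case True
    then show ?thesis
      using near[of n m] N[of n] that by simp
  next
    case False
    then show ?thesis
      using near[of m n] N[of m] that l2_norm_diff_commute[of M "s m" "s n"] by simp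
  qed
  then show "\<exists>N. \<forall>m\<ge>N. \<forall>n\<ge>N. l2_norm M (\<lambda>x. s m x - s n x) < e"
    by blast
qed

end

locale l2_frame_space = l2_hilbert M H for M :: "'a measure" and H +
  fixes I :: "'i set" and \<theta> :: "'i \<Rightarrow> 'a \<Rightarrow> real" and a b :: real
  assumes bounds: "frame_bounds M H I \<theta> a b"
begin

lemma a_pos: "0 < a" and a_le_b: "a \<le> b" and b_pos: "0 < b"
  using bounds by (auto simp: frame_bounds_def)

lemma frame_in [simp]: "i \<in> I \<Longrightarrow> \<theta> i \<in> H"
  using bounds by (auto simp: frame_bounds_def)

lemma coeff_summable: "f \<in> H \<Longrightarrow> (\<lambda>i. (l2_inner M f (\<theta> i))\<^sup>2) summable_on I"
  using bounds by (simp add: frame_bounds_def)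

text \<open>Synthesis is adjoint to analysis. Pairing the sum \<open>u\<close> with itself gives the
  sum of \<open>c i\<close> times the coefficients of \<open>u\<close>; Cauchy-Schwarz for finite
  sums and the upper frame bound give \<open>\<le>\<close> with a factor
  \<open>b * l2_inner M u u\<close>, and one power of \<open>l2_inner M u u\<close> cancels.\<close>

lemma synthesis_norm_le:
  assumes "finite F" "F \<subseteq> I"
  shows "(l2_norm M (\<lambda>x. \<Sum>i\<in>F. c i * \<theta> i x))\<^sup>2 \<le> b * (\<Sum>i\<in>F. (c i)\<^sup>2)"
proof -
  define u where "u = (\<lambda>x. \<Sum>i\<in>F. c i * \<theta> i x)"
  have u: "u \<in> H"
    unfolding u_def using assms by (intro sum_in scale_in frame_in) auto
  have coeff: "(\<Sum>i\<in>F. (l2_inner M u (\<theta> i))\<^sup>2) \<le> b * (l2_norm M u)\<^sup>2"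
  proof -
    have "(\<Sum>i\<in>F. (l2_inner M u (\<theta> i))\<^sup>2) \<le> (\<Sum>\<^sub>\<infinity>i\<in>I. (l2_inner M u (\<theta> i))\<^sup>2)"
      using assms u by (intro finite_sum_le_infsum coeff_summable) auto
    then show ?thesis
      using bounds u by (auto simp: frame_bounds_def)
  qed
  have "l2_inner M u u = (\<Sum>i\<in>F. c i * l2_inner M u (\<theta> i))"
  proof -
    have "\<theta> i \<in> L2 M" if "i \<in> F" for i
      using assms that by auto
    then have "l2_inner M (\<lambda>x. \<Sum>i\<in>F. c i * \<theta> i x) u = (\<Sum>i\<in>F. l2_inner M (\<lambda>x. c i * \<theta> i x) u)"
      using u by (intro l2_inner_sum_left) auto
    then have "l2_inner M u u = (\<Sum>i\<in>F. l2_inner M (\<lambda>x. c i * \<theta> i x) u)"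
      by (simp only: u_def[symmetric])
    also have "\<dots> = (\<Sum>i\<in>F. c i * l2_inner M u (\<theta> i))"
      by (intro sum.cong refl) (metis l2_inner_scale_left l2_inner_commute)
    finally show ?thesis .
  qed
  then have "(l2_inner M u u)\<^sup>2 \<le> (\<Sum>i\<in>F. (c i)\<^sup>2) * (\<Sum>i\<in>F. (l2_inner M u (\<theta> i))\<^sup>2)"
    using Cauchy_Schwarz_ineq_sum[of c "\<lambda>i. l2_inner M u (\<theta> i)" F] by simp
  also have "\<dots> \<le> (\<Sum>i\<in>F. (c i)\<^sup>2) * (b * l2_inner M u u)"
    using coeff by (intro mult_left_mono) (auto simp: l2_norm_power2 sum_nonneg)
  finally have "l2_inner M u u * l2_inner M u u \<le> (b * (\<Sum>i\<in>F. (c i)\<^sup>2)) * l2_inner M u u"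
    by (simp add: power2_eq_square mult_ac)
  moreover have "0 \<le> b * (\<Sum>i\<in>F. (c i)\<^sup>2)"
    using b_pos by (simp add: sum_nonneg)
  ultimately have "l2_inner M u u \<le> b * (\<Sum>i\<in>F. (c i)\<^sup>2)"
    using l2_inner_self_nonneg[of M u] by (metis mult_right_le_imp_le order_le_less)
  then show ?thesis
    by (simp add: l2_norm_power2 u_def)
qed

text \<open>The partial sums form a Cauchy net over finite index sets, whereas completeness speaks
  of sequences. Finite sets \<open>A n\<close> with tail error at most \<open>1 / (n + 1)\<close>
  yield a Cauchy sequence, and its limit is the limit of the whole net.\<close>

lemma synthesis_converges:
  assumes c: "(\<lambda>i. (c i)\<^sup>2) summable_on I"
  shows "\<exists>g\<in>H. l2_has_sum M (\<lambda>i x. c i * \<theta> i x) I g"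
proof -
  define S where "S = (\<lambda>F x. \<Sum>i\<in>F. c i * \<theta> i x)"
  have S: "S F \<in> H" if "F \<subseteq> I" for F
    unfolding S_def using that by (intro sum_in scale_in frame_in) auto
  have cauchy: "\<exists>F. finite F \<and> F \<subseteq> I \<and>
      (\<forall>G. finite G \<longrightarrow> F \<subseteq> G \<longrightarrow> G \<subseteq> I \<longrightarrow> l2_norm M (\<lambda>x. S G x - S F x) \<le> e)" if "0 < e" for e
  proof -
    define T where "T = (\<Sum>\<^sub>\<infinity>i\<in>I. (c i)\<^sup>2)"
    have "((\<lambda>F. \<Sum>i\<in>F. (c i)\<^sup>2) \<longlongrightarrow> T) (finite_subsets_at_top I)"
      using has_sum_infsum[OF c] by (simp add: has_sum_def T_def)
    \<comment> \<open>The tolerance \<open>e\<^sup>2 / b\<close> for the coefficients is what the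
      factor \<open>b\<close> of \<open>synthesis_norm_le\<close> turns into
      \<open>e\<^sup>2\<close>.\<close>
    moreover have "T - e\<^sup>2 / b < T"
      using that b_pos by simp
    ultimately have "\<forall>\<^sub>F F in finite_subsets_at_top I. T - e\<^sup>2 / b < (\<Sum>i\<in>F. (c i)\<^sup>2)"
      by (rule order_tendstoD)
    then obtain F where F: "finite F" "F \<subseteq> I" "T - e\<^sup>2 / b < (\<Sum>i\<in>F. (c i)\<^sup>2)"
      unfolding eventually_finite_subsets_at_top by blast
    have "l2_norm M (\<lambda>x. S G x - S F x) \<le> e" if G: "finite G" "F \<subseteq> G" "G \<subseteq> I" for G
    proof (rule power2_le_imp_le)
      have "(\<Sum>i\<in>G. (c i)\<^sup>2) \<le> T"
        unfolding T_def using G c by (intro finite_sum_le_infsum) auto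
      moreover have "(\<Sum>i\<in>G. (c i)\<^sup>2) = (\<Sum>i\<in>G - F. (c i)\<^sup>2) + (\<Sum>i\<in>F. (c i)\<^sup>2)"
        using G by (intro sum.subset_diff)
      ultimately have "(\<Sum>i\<in>G - F. (c i)\<^sup>2) \<le> e\<^sup>2 / b"
        using F by linarith
      then have "b * (\<Sum>i\<in>G - F. (c i)\<^sup>2) \<le> e\<^sup>2"
        using b_pos by (simp add: field_simps)
      moreover have "(\<lambda>x. S G x - S F x) = (\<lambda>x. \<Sum>i\<in>G - F. c i * \<theta> i x)"
        using G by (simp add: S_def sum.subset_diff[of F G] fun_eq_iff)
      moreover have "(l2_norm M (\<lambda>x. \<Sum>i\<in>G - F. c i * \<theta> i x))\<^sup>2 \<le> b * (\<Sum>i\<in>G - F. (c i)\<^sup>2)"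
        using G by (intro synthesis_norm_le) auto
      ultimately show "(l2_norm M (\<lambda>x. S G x - S F x))\<^sup>2 \<le> e\<^sup>2"
        by simp
    qed (use \<open>0 < e\<close> in simp)
    with F show ?thesis by blast
  qed
  define r where "r = (\<lambda>n. inverse (real (Suc n)))"
  have r: "0 < r n" for n
    by (simp add: r_def)
  have r_lim: "r \<longlonglongrightarrow> 0"
    unfolding r_def by (rule LIMSEQ_inverse_real_of_nat)
  obtain A where A: "\<And>n. finite (A n)" "\<And>n. A n \<subseteq> I"
    and near: "\<And>n G. finite G \<Longrightarrow> A n \<subseteq> G \<Longrightarrow> G \<subseteq> I \<Longrightarrow> l2_norm M (\<lambda>x. S G x - S (A n) x) \<le> r n"
    using cauchy[OF r] by metis
  have "\<exists>g\<in>H. (\<lambda>n. l2_norm M (\<lambda>x. S (A n) x - g x)) \<longlonglongrightarrow> 0"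
  proof (rule complete)
    show "range (\<lambda>n. S (A n)) \<subseteq> H"
      using S A by auto
    fix e :: real assume "0 < e"
    then have "\<forall>\<^sub>F n in sequentially. r n < e / 2"
      by (intro order_tendstoD(2)[OF r_lim]) auto
    then obtain n0 where n0: "\<And>n. n \<ge> n0 \<Longrightarrow> r n < e / 2"
      by (auto simp: eventually_sequentially)
    have "l2_norm M (\<lambda>x. S (A m) x - S (A n) x) < e" if "n0 \<le> m" "n0 \<le> n" for m n
    proof -
      \<comment> \<open>The sets \<open>A n\<close> need not be nested, so two of them are compared
        through their union.\<close>
      define G where "G = A m \<union> A n"
      have G: "finite G" "A m \<subseteq> G" "A n \<subseteq> G" "G \<subseteq> I"
        using A by (auto simp: G_def)
      have "l2_norm M (\<lambda>x. S (A m) x - S (A n) x)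
          \<le> l2_norm M (\<lambda>x. S (A m) x - S G x) + l2_norm M (\<lambda>x. S G x - S (A n) x)"
        using S A G by (intro l2_norm_triangle_diff in_L2) auto
      then show ?thesis
        using near[OF G(1,2,4)] near[OF G(1,3,4)] n0[OF that(1)] n0[OF that(2)]
        by (simp add: l2_norm_diff_commute[of M "S (A m)" "S G"])
    qed
    then show "\<exists>N. \<forall>m\<ge>N. \<forall>n\<ge>N. l2_norm M (\<lambda>x. S (A m) x - S (A n) x) < e"
      by blast
  qed
  then obtain g where g: "g \<in> H" and g_lim: "(\<lambda>n. l2_norm M (\<lambda>x. S (A n) x - g x)) \<longlonglongrightarrow> 0"
    by blast
  have "((\<lambda>F. l2_norm M (\<lambda>x. g x - S F x)) \<longlongrightarrow> 0) (finite_subsets_at_top I)"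
  proof (rule order_tendstoI)
    fix e :: real assume "0 < e"
    have "(\<lambda>n. r n + l2_norm M (\<lambda>x. S (A n) x - g x)) \<longlonglongrightarrow> 0 + 0"
      by (intro tendsto_add r_lim g_lim)
    then have "\<forall>\<^sub>F n in sequentially. r n + l2_norm M (\<lambda>x. S (A n) x - g x) < e"
      using \<open>0 < e\<close> by (auto intro: order_tendstoD(2))
    then obtain n where n: "r n + l2_norm M (\<lambda>x. S (A n) x - g x) < e"
      by (auto simp: eventually_sequentially)
    have "l2_norm M (\<lambda>x. g x - S F x) < e" if F: "finite F" "A n \<subseteq> F" "F \<subseteq> I" for F
    proof -
      have "l2_norm M (\<lambda>x. S F x - g x)
          \<le> l2_norm M (\<lambda>x. S F x - S (A n) x) + l2_norm M (\<lambda>x. S (A n) x - g x)"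
        using S A F g by (intro l2_norm_triangle_diff in_L2) auto
      then show ?thesis
        using near[OF F] n by (simp add: l2_norm_diff_commute[of M g "S F"])
    qed
    then show "\<forall>\<^sub>F F in finite_subsets_at_top I. l2_norm M (\<lambda>x. g x - S F x) < e"
      unfolding eventually_finite_subsets_at_top using A by (intro exI[of _ "A n"]) simp
  next
    fix e :: real assume "e < 0"
    then show "\<forall>\<^sub>F F in finite_subsets_at_top I. e < l2_norm M (\<lambda>x. g x - S F x)"
      by (intro always_eventually allI less_le_trans[OF _ l2_norm_nonneg])
  qed
  with g show ?thesis
    unfolding l2_has_sum_def S_def by blast
qed

section \<open>The frame operator and its relaxation\<close>

abbreviation \<Phi> :: "('a \<Rightarrow> real) \<Rightarrow> ('a \<Rightarrow> real)" where
  "\<Phi> \<equiv> frame_operator M H I \<theta>"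

lemma frame_operator:
  assumes "f \<in> H"
  shows frame_operator_in [simp]: "\<Phi> f \<in> H"
    and frame_operator_has_sum: "l2_has_sum M (\<lambda>i x. l2_inner M f (\<theta> i) * \<theta> i x) I (\<Phi> f)"
proof -
  have "\<exists>g. g \<in> H \<and> l2_has_sum M (\<lambda>i x. l2_inner M f (\<theta> i) * \<theta> i x) I g"
    using synthesis_converges[OF coeff_summable[OF assms]] by blast
  from someI_ex[OF this] show "\<Phi> f \<in> H"
    and "l2_has_sum M (\<lambda>i x. l2_inner M f (\<theta> i) * \<theta> i x) I (\<Phi> f)"
    by (simp_all add: frame_operator_def)
qed

text \<open>The chosen \<open>\<Phi> f\<close> is fixed only up to a null function; this weak
  formula does not see the choice, and it makes the symmetry of \<open>\<Phi>\<close> and its form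
  bounds visible.\<close>

lemma frame_operator_inner:
  assumes "f \<in> H" "k \<in> H"
  shows "l2_inner M (\<Phi> f) k = (\<Sum>\<^sub>\<infinity>i\<in>I. l2_inner M f (\<theta> i) * l2_inner M k (\<theta> i))"
  using l2_has_sum_inner[OF frame_operator_has_sum[OF assms(1)], of k] assms
  by (simp add: infsumI l2_inner_commute)

lemma frame_operator_symmetric:
  "f \<in> H \<Longrightarrow> k \<in> H \<Longrightarrow> l2_inner M (\<Phi> f) k = l2_inner M f (\<Phi> k)"
  by (simp add: frame_operator_inner l2_inner_commute[of M f] mult.commute)

lemma frame_operator_bounds:
  assumes "f \<in> H"
  shows "a * (l2_norm M f)\<^sup>2 \<le> l2_inner M (\<Phi> f) f" "l2_inner M (\<Phi> f) f \<le> b * (l2_norm M f)\<^sup>2"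
  using bounds assms by (auto simp: frame_bounds_def frame_operator_inner simp flip: power2_eq_square)

text \<open>The factor \<open>\<eta>\<close> of the frame algorithm: the form of
  \<open>1 - \<tau> * \<Phi>\<close> lies between \<open>1 - \<tau> * b\<close> and
  \<open>1 - \<tau> * a\<close> on unit vectors.\<close>

definition relaxation_factor :: "real \<Rightarrow> real" where
  "relaxation_factor \<tau> = max \<bar>1 - \<tau> * a\<bar> \<bar>1 - \<tau> * b\<bar>"

lemma relaxation_factor_nonneg: "0 \<le> relaxation_factor \<tau>"
  by (simp add: relaxation_factor_def)

lemma relaxation_factor_less_1:
  assumes "0 < \<tau>" "\<tau> < 2 / b"
  shows "relaxation_factor \<tau> < 1"
proof -
  have "\<tau> * b < 2"
    using assms b_pos by (simp add: field_simps)
  moreover have "0 < \<tau> * a" "\<tau> * a \<le> \<tau> * b"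
    using assms a_pos a_le_b by auto
  ultimately show ?thesis
    unfolding relaxation_factor_def by linarith
qed

lemma relaxation_norm_le:
  assumes "0 < \<tau>" "f \<in> H"
  shows "l2_norm M (\<lambda>x. f x - \<tau> * \<Phi> f x) \<le> relaxation_factor \<tau> * l2_norm M f"
proof (rule symmetric_operator_norm_le[where R = "\<lambda>f x. f x - \<tau> * \<Phi> f x"])
  fix f assume f: "f \<in> H"
  have "l2_inner M (\<lambda>x. f x - \<tau> * \<Phi> f x) f = (l2_norm M f)\<^sup>2 - \<tau> * l2_inner M (\<Phi> f) f"
    using f by (simp add: l2_norm_power2)
  moreover have "\<tau> * (a * (l2_norm M f)\<^sup>2) \<le> \<tau> * l2_inner M (\<Phi> f) f"
    "\<tau> * l2_inner M (\<Phi> f) f \<le> \<tau> * (b * (l2_norm M f)\<^sup>2)"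
    using frame_operator_bounds[OF f] \<open>0 < \<tau>\<close> by auto
  ultimately have "l2_inner M (\<lambda>x. f x - \<tau> * \<Phi> f x) f \<le> (1 - \<tau> * a) * (l2_norm M f)\<^sup>2"
    "(1 - \<tau> * b) * (l2_norm M f)\<^sup>2 \<le> l2_inner M (\<lambda>x. f x - \<tau> * \<Phi> f x) f"
    by (simp_all add: algebra_simps)
  moreover have "(1 - \<tau> * a) * (l2_norm M f)\<^sup>2 \<le> relaxation_factor \<tau> * (l2_norm M f)\<^sup>2"
    "- relaxation_factor \<tau> * (l2_norm M f)\<^sup>2 \<le> (1 - \<tau> * b) * (l2_norm M f)\<^sup>2"
    unfolding relaxation_factor_def by (intro mult_right_mono; simp)+
  ultimately show "\<bar>l2_inner M (\<lambda>x. f x - \<tau> * \<Phi> f x) f\<bar> \<le> relaxation_factor \<tau> * (l2_norm M f)\<^sup>2"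
    by linarith
qed (use assms in \<open>auto simp: frame_operator_symmetric relaxation_factor_nonneg\<close>)

lemma frame_operator_norm_le:
  assumes "f \<in> H"
  shows "l2_norm M (\<Phi> f) \<le> b * l2_norm M f"
proof (rule symmetric_operator_norm_le)
  fix f assume "f \<in> H"
  moreover from this have "0 \<le> a * (l2_norm M f)\<^sup>2"
    using a_pos by simp
  ultimately show "\<bar>l2_inner M (\<Phi> f) f\<bar> \<le> b * (l2_norm M f)\<^sup>2"
    using frame_operator_bounds[of f] by linarith
qed (use assms b_pos in \<open>auto simp: frame_operator_symmetric\<close>)

lemma frame_iter_in [simp]: "f \<in> H \<Longrightarrow> frame_iter M H I \<theta> \<tau> f n \<in> H"
  by (induction n) auto

lemma frame_iter_error:
  assumes "0 < \<tau>" "f \<in> H"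
  shows "l2_norm M (\<lambda>x. f x - frame_iter M H I \<theta> \<tau> f n x) \<le> relaxation_factor \<tau> ^ n * l2_norm M f"
proof (induction n)
  case (Suc n)
  define e where "e = (\<lambda>x. f x - frame_iter M H I \<theta> \<tau> f n x)"
  \<comment> \<open>This recursion for the error is an equality of functions, because the iteration
    applies \<open>\<Phi>\<close> to the very function \<open>e\<close>; no additivity of
    \<open>\<Phi>\<close> enters.\<close>
  have "l2_norm M (\<lambda>x. f x - frame_iter M H I \<theta> \<tau> f (Suc n) x) = l2_norm M (\<lambda>x. e x - \<tau> * \<Phi> e x)"
    by (simp add: e_def algebra_simps)
  also have "\<dots> \<le> relaxation_factor \<tau> * l2_norm M e"
    using assms by (intro relaxation_norm_le) (simp_all add: e_def)
  also have "\<dots> \<le> relaxation_factor \<tau> * (relaxation_factor \<tau> ^ n * l2_norm M f)"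
    using Suc by (intro mult_left_mono relaxation_factor_nonneg) (simp add: e_def)
  finally show ?case
    by simp
qed simp

theorem frame_algorithm_converges: "frame_algorithm_converges M H I \<theta> a b"
proof -
  have "relaxation_factor \<tau> = (b - a) / (a + b)" if "\<tau> = 2 / (a + b)" for \<tau>
  proof -
    have "1 - \<tau> * a = (b - a) / (a + b)" "1 - \<tau> * b = - ((b - a) / (a + b))"
      unfolding that using a_pos b_pos by (simp_all add: field_simps)
    moreover have "0 \<le> (b - a) / (a + b)"
      using a_pos a_le_b by simp
    ultimately show ?thesis
      unfolding relaxation_factor_def by (simp only: abs_minus_cancel max.idem abs_of_nonneg)
  qed
  moreover have "(\<lambda>n. l2_norm M (\<lambda>x. f x - frame_iter M H I \<theta> \<tau> f n x)) \<longlonglongrightarrow> 0"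
    if "0 < \<tau>" "\<tau> < 2 / b" "f \<in> H" for \<tau> f
  proof (rule Lim_null_comparison)
    show "(\<lambda>n. relaxation_factor \<tau> ^ n * l2_norm M f) \<longlonglongrightarrow> 0"
      using that relaxation_factor_less_1 relaxation_factor_nonneg
      by (intro tendsto_mult_left_zero LIMSEQ_realpow_zero) auto
    show "\<forall>\<^sub>F n in sequentially. norm (l2_norm M (\<lambda>x. f x - frame_iter M H I \<theta> \<tau> f n x))
        \<le> relaxation_factor \<tau> ^ n * l2_norm M f"
      using that frame_iter_error by simp
  qed
  ultimately show ?thesis
    unfolding frame_algorithm_converges_def Let_def relaxation_factor_def[symmetric]
    using frame_operator frame_iter_error relaxation_factor_less_1
    by simp
qed

text \<open>A Banach fixed point argument: \<open>K g = g + \<tau> * (h - \<Phi> g)\<close> is a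
  contraction for \<open>\<tau> = 1 / b\<close>, and a fixed point solves
  \<open>\<Phi> g = h\<close>, both up to null functions.\<close>

lemma frame_operator_surjective:
  assumes h: "h \<in> H"
  shows "\<exists>g\<in>H. l2_norm M (\<lambda>x. \<Phi> g x - h x) = 0"
proof -
  define \<tau> where "\<tau> = 1 / b"
  have \<tau>: "0 < \<tau>" "\<tau> < 2 / b"
    using b_pos by (auto simp: \<tau>_def divide_strict_right_mono)
  define K where "K = (\<lambda>g x. g x + \<tau> * (h x - \<Phi> g x))"
  define \<eta> where "\<eta> = relaxation_factor \<tau>"
  have \<eta>: "0 \<le> \<eta>" "\<eta> < 1"
    using \<tau> by (auto simp: \<eta>_def relaxation_factor_nonneg relaxation_factor_less_1)
  have K: "K g \<in> H" if "g \<in> H" for g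
    unfolding K_def using h that by simp
  have contraction: "l2_norm M (\<lambda>x. K g x - K g' x) \<le> \<eta> * l2_norm M (\<lambda>x. g x - g' x)"
    if g: "g \<in> H" "g' \<in> H" for g g'
  proof -
    define d where "d = (\<lambda>x. g x - g' x)"
    have d: "d \<in> H"
      using g by (simp add: d_def)
    \<comment> \<open>The two functions agree only almost everywhere, since \<open>\<Phi>\<close> is
      additive only in that sense; their norms are compared through pairings with elements of
      \<open>H\<close>.\<close>
    have "l2_norm M (\<lambda>x. K g x - K g' x) = l2_norm M (\<lambda>x. d x - \<tau> * \<Phi> d x)"
    proof (rule norm_eq_if_inner_eq)
      fix k assume k: "k \<in> H"
      have "l2_inner M (\<Phi> d) k = l2_inner M (\<Phi> g) k - l2_inner M (\<Phi> g') k"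
        using d g k by (simp add: frame_operator_symmetric d_def)
      then show "l2_inner M (\<lambda>x. K g x - K g' x) k = l2_inner M (\<lambda>x. d x - \<tau> * \<Phi> d x) k"
        using d g k h by (simp add: K_def) (simp add: d_def algebra_simps)
    qed (use d g K in auto)
    then show ?thesis
      using relaxation_norm_le[OF \<tau>(1) d] by (simp add: d_def \<eta>_def)
  qed
  define s where "s = (\<lambda>n. (K ^^ n) (\<lambda>x. 0))"
  have s: "s n \<in> H" for n
    by (induction n) (auto simp: s_def K)
  have "\<exists>f\<in>H. (\<lambda>n. l2_norm M (\<lambda>x. s n x - f x)) \<longlonglongrightarrow> 0"
  proof (rule geometric_sequence_converges[OF s _ \<eta>])
    define c where "c = l2_norm M (\<lambda>x. s 1 x - s 0 x)"
    then show "0 \<le> c" by simp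
    show "l2_norm M (\<lambda>x. s (Suc n) x - s n x) \<le> c * \<eta> ^ n" for n
    proof (induction n)
      case (Suc n)
      have "l2_norm M (\<lambda>x. s (Suc (Suc n)) x - s (Suc n) x) \<le> \<eta> * l2_norm M (\<lambda>x. s (Suc n) x - s n x)"
        using contraction[OF s[of "Suc n"] s[of n]] by (simp add: s_def)
      also have "\<dots> \<le> \<eta> * (c * \<eta> ^ n)"
        using Suc \<eta> by (intro mult_left_mono)
      finally show ?case
        by (simp add: mult_ac)
    qed (simp add: c_def)
  qed
  then obtain g where g: "g \<in> H" and lim: "(\<lambda>n. l2_norm M (\<lambda>x. s n x - g x)) \<longlonglongrightarrow> 0"
    by blast
  \<comment> \<open>Since \<open>s (Suc n) = K (s n)\<close>, the limit \<open>g\<close> moves under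
    \<open>K\<close> by no more than its distances to two consecutive iterates allow.\<close>
  have le: "l2_norm M (\<lambda>x. K g x - g x) \<le> \<eta> * l2_norm M (\<lambda>x. s n x - g x)
      + l2_norm M (\<lambda>x. s (Suc n) x - g x)" for n
    using l2_norm_triangle_diff[of "K g" M "s (Suc n)" g] contraction[OF g s[of n]] g s K
    by (simp add: s_def l2_norm_diff_commute[of M g])
  have "(\<lambda>n. \<eta> * l2_norm M (\<lambda>x. s n x - g x) + l2_norm M (\<lambda>x. s (Suc n) x - g x)) \<longlonglongrightarrow> \<eta> * 0 + 0"
    by (intro tendsto_intros lim LIMSEQ_Suc)
  then have "l2_norm M (\<lambda>x. K g x - g x) \<le> \<eta> * 0 + 0"
    by (rule tendsto_lowerbound) (simp_all add: le)
  moreover have "l2_norm M (\<lambda>x. K g x - g x) = \<tau> * l2_norm M (\<lambda>x. \<Phi> g x - h x)"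
    using \<tau> l2_norm_scale[of M \<tau> "\<lambda>x. h x - \<Phi> g x"]
    by (simp add: K_def l2_norm_diff_commute[of M "\<Phi> g"])
  ultimately have "l2_norm M (\<lambda>x. \<Phi> g x - h x) \<le> 0"
    using \<tau> by (simp add: mult_le_0_iff)
  then have "l2_norm M (\<lambda>x. \<Phi> g x - h x) = 0"
    using l2_norm_nonneg antisym by blast
  with g show ?thesis
    by blast
qed

section \<open>The inverse frame operator and the canonical dual frame\<close>

definition frame_inverse :: "('a \<Rightarrow> real) \<Rightarrow> ('a \<Rightarrow> real)" (\<open>\<Psi>\<close>) where
  "\<Psi> h = (SOME g. g \<in> H \<and> l2_norm M (\<lambda>x. \<Phi> g x - h x) = 0)"

lemma
  assumes "h \<in> H"
  shows frame_inverse_in [simp]: "\<Psi> h \<in> H" and frame_inverse_inverse: "l2_norm M (\<lambda>x. \<Phi> (\<Psi> h) x - h x) = 0"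
proof -
  have "\<exists>g. g \<in> H \<and> l2_norm M (\<lambda>x. \<Phi> g x - h x) = 0"
    using frame_operator_surjective[OF assms] by blast
  from someI_ex[OF this] show "\<Psi> h \<in> H" "l2_norm M (\<lambda>x. \<Phi> (\<Psi> h) x - h x) = 0"
    by (simp_all add: frame_inverse_def)
qed

lemma inner_frame_operator_inverse:
  assumes "h \<in> H" "k \<in> H"
  shows "l2_inner M (\<Phi> (\<Psi> h)) k = l2_inner M h k"
  using l2_inner_null_left[OF _ _ frame_inverse_inverse, of h k] assms by simp

lemma frame_inverse_symmetric:
  assumes "h \<in> H" "k \<in> H"
  shows "l2_inner M (\<Psi> h) k = l2_inner M h (\<Psi> k)"
proof -
  have "l2_inner M (\<Psi> h) k = l2_inner M (\<Psi> h) (\<Phi> (\<Psi> k))"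
    using inner_frame_operator_inverse[of k "\<Psi> h"] assms by (simp add: l2_inner_commute)
  also have "\<dots> = l2_inner M h (\<Psi> k)"
    using inner_frame_operator_inverse[of h "\<Psi> k"] assms by (simp add: frame_operator_symmetric)
  finally show ?thesis .
qed

text \<open>The lower frame bound at \<open>\<Psi> h\<close> and Cauchy-Schwarz give the first
  estimate; the second is the bound \<open>b\<close> on the norm of \<open>\<Phi>\<close>, applied
  to \<open>\<Psi> h\<close>.\<close>

lemma frame_inverse_norm_bounds:
  assumes "h \<in> H"
  shows "l2_norm M (\<Psi> h) \<le> l2_norm M h / a" "l2_norm M h / b \<le> l2_norm M (\<Psi> h)"
proof -
  have "a * (l2_norm M (\<Psi> h))\<^sup>2 \<le> l2_inner M h (\<Psi> h)"
    using frame_operator_bounds(1)[of "\<Psi> h"] assms by (simp add: inner_frame_operator_inverse)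
  also have "\<dots> \<le> l2_norm M h * l2_norm M (\<Psi> h)"
    using l2_cauchy_schwarz[of h M "\<Psi> h"] assms by simp
  finally have "(a * l2_norm M (\<Psi> h)) * l2_norm M (\<Psi> h) \<le> l2_norm M h * l2_norm M (\<Psi> h)"
    by (simp add: power2_eq_square mult_ac)
  then have "a * l2_norm M (\<Psi> h) \<le> l2_norm M h"
    using l2_norm_nonneg[of M "\<Psi> h"] l2_norm_nonneg[of M h]
    by (metis mult_right_le_imp_le mult_zero_right order_le_less)
  then show "l2_norm M (\<Psi> h) \<le> l2_norm M h / a"
    using a_pos by (simp add: field_simps)
  have "l2_norm M h = l2_norm M (\<Phi> (\<Psi> h))"
    using assms by (intro norm_eq_if_inner_eq) (simp_all add: inner_frame_operator_inverse)
  then show "l2_norm M h / b \<le> l2_norm M (\<Psi> h)"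
    using frame_operator_norm_le[of "\<Psi> h"] assms b_pos by (simp add: field_simps)
qed

text \<open>By symmetry of \<open>\<Psi>\<close>, the coefficients of \<open>f\<close> against
  \<open>\<Psi> (\<theta> i)\<close> are those of \<open>\<Psi> f\<close> against
  \<open>\<theta> i\<close>. The original bounds combined with the norm bounds on
  \<open>\<Psi>\<close> give these constants, which make no claim to be optimal.\<close>

lemma canonical_dual_bounds: "frame_bounds M H I (\<lambda>i. \<Psi> (\<theta> i)) (a / b\<^sup>2) (b / a\<^sup>2)"
  unfolding frame_bounds_def
proof (intro conjI ballI)
  show "0 < a / b\<^sup>2"
    using a_pos b_pos by simp
  have "a * a\<^sup>2 \<le> b * b\<^sup>2"
    using a_pos a_le_b by (intro mult_mono power_mono) auto
  then show "a / b\<^sup>2 \<le> b / a\<^sup>2"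
    using a_pos b_pos by (simp add: field_simps)
  show "\<Psi> (\<theta> i) \<in> H" if "i \<in> I" for i
    using that by simp
  fix f assume f: "f \<in> H"
  have coeff: "l2_inner M f (\<Psi> (\<theta> i)) = l2_inner M (\<Psi> f) (\<theta> i)" if "i \<in> I" for i
    using f that by (simp add: frame_inverse_symmetric)
  have eq: "(\<Sum>\<^sub>\<infinity>i\<in>I. (l2_inner M f (\<Psi> (\<theta> i)))\<^sup>2) = (\<Sum>\<^sub>\<infinity>i\<in>I. (l2_inner M (\<Psi> f) (\<theta> i))\<^sup>2)"
    by (intro infsum_cong) (simp add: coeff)
  have frame: "a * (l2_norm M (\<Psi> f))\<^sup>2 \<le> (\<Sum>\<^sub>\<infinity>i\<in>I. (l2_inner M (\<Psi> f) (\<theta> i))\<^sup>2)"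
    "(\<Sum>\<^sub>\<infinity>i\<in>I. (l2_inner M (\<Psi> f) (\<theta> i))\<^sup>2) \<le> b * (l2_norm M (\<Psi> f))\<^sup>2"
    using bounds f by (auto simp: frame_bounds_def)
  show "(\<lambda>i. (l2_inner M f (\<Psi> (\<theta> i)))\<^sup>2) summable_on I"
    using coeff_summable[of "\<Psi> f"] f by (simp add: coeff cong: summable_on_cong)
  have "a * (l2_norm M f / b)\<^sup>2 \<le> a * (l2_norm M (\<Psi> f))\<^sup>2"
    using frame_inverse_norm_bounds(2)[OF f] a_pos b_pos by (intro mult_left_mono power_mono) auto
  then show "a / b\<^sup>2 * (l2_norm M f)\<^sup>2 \<le> (\<Sum>\<^sub>\<infinity>i\<in>I. (l2_inner M f (\<Psi> (\<theta> i)))\<^sup>2)"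
    using frame by (simp add: eq power_divide)
  have "b * (l2_norm M (\<Psi> f))\<^sup>2 \<le> b * (l2_norm M f / a)\<^sup>2"
    using frame_inverse_norm_bounds(1)[OF f] b_pos by (intro mult_left_mono power_mono) auto
  then show "(\<Sum>\<^sub>\<infinity>i\<in>I. (l2_inner M f (\<Psi> (\<theta> i)))\<^sup>2) \<le> b / a\<^sup>2 * (l2_norm M f)\<^sup>2"
    using frame by (simp add: eq power_divide)
qed

text \<open>The series converges because the dual family is itself a frame. Its limit is identified
  weakly: pairing with \<open>k\<close> gives \<open>l2_inner M (\<Phi> f) (\<Psi> k)\<close>, which
  equals \<open>l2_inner M f k\<close> after moving \<open>\<Phi>\<close> to the other side.\<close>

theorem canonical_dual_frame: "dual_frame M H I \<theta> (\<lambda>i. \<Psi> (\<theta> i))"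
  unfolding dual_frame_def
proof (intro conjI ballI)
  show "l2_frame M H I (\<lambda>i. \<Psi> (\<theta> i))"
    using canonical_dual_bounds by (auto simp: l2_frame_def)
  interpret dual: l2_frame_space M H I "\<lambda>i. \<Psi> (\<theta> i)" "a / b\<^sup>2" "b / a\<^sup>2"
    by unfold_locales (rule canonical_dual_bounds)
  fix f assume f: "f \<in> H"
  obtain s where s: "s \<in> H"
    and sum: "l2_has_sum M (\<lambda>i x. l2_inner M f (\<theta> i) * \<Psi> (\<theta> i) x) I s"
    using dual.synthesis_converges[OF coeff_summable[OF f]] by blast
  have "l2_norm M (\<lambda>x. f x - s x) = 0"
  proof (rule norm_eq_0_if_orthogonal)
    fix k assume k: "k \<in> H"
    have term_eq: "l2_inner M (\<Psi> (\<theta> i)) k = l2_inner M (\<Psi> k) (\<theta> i)" if "i \<in> I" for i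
      using frame_inverse_symmetric[of "\<theta> i" k] k that l2_inner_commute[of M "\<theta> i" "\<Psi> k"]
      by (metis frame_in)
    have "((\<lambda>i. l2_inner M f (\<theta> i) * l2_inner M (\<Psi> (\<theta> i)) k) has_sum l2_inner M s k) I"
      using l2_has_sum_inner[OF sum, of k] s k by simp
    then have "l2_inner M s k = (\<Sum>\<^sub>\<infinity>i\<in>I. l2_inner M f (\<theta> i) * l2_inner M (\<Psi> (\<theta> i)) k)"
      by (simp add: infsumI)
    also have "\<dots> = (\<Sum>\<^sub>\<infinity>i\<in>I. l2_inner M f (\<theta> i) * l2_inner M (\<Psi> k) (\<theta> i))"
      by (intro infsum_cong) (simp add: term_eq)
    also have "\<dots> = l2_inner M (\<Phi> f) (\<Psi> k)"
      using f k by (simp add: frame_operator_inner)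
    also have "\<dots> = l2_inner M f k"
      using f k inner_frame_operator_inverse[of k f] by (simp add: frame_operator_symmetric l2_inner_commute)
    finally show "l2_inner M (\<lambda>x. f x - s x) k = 0"
      using f s k by simp
  qed (use f s in simp)
  then show "l2_has_sum M (\<lambda>i x. l2_inner M f (\<theta> i) * \<Psi> (\<theta> i) x) I f"
    using f s by (intro l2_has_sum_cong_null[OF sum]) auto
qed

end

section \<open>Spectral subspaces\<close>

locale root_spectral_measure =
  fixes M :: "'a measure" and S :: "'a l2_graph"
    and P :: "real set \<Rightarrow> ('a \<Rightarrow> real) \<Rightarrow> ('a \<Rightarrow> real)"
  assumes nonneg_self_adjoint: "nonneg_self_adjoint M S"
    and spectral: "spectral_measure_of M S P"
begin

lemma pvm: "projection_valued_measure M P"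
  using spectral unfolding spectral_measure_of_def by (rule conjunct1)

lemmas pvm_unfolded = pvm[unfolded projection_valued_measure_def]

lemmas P_rules = pvm_unfolded[THEN conjunct1, rule_format]

lemmas P_in [simp] = P_rules[THEN conjunct1]

lemmas P_cong = P_rules[THEN conjunct2, THEN conjunct1, rule_format]

lemmas P_lincomb = P_rules[THEN conjunct2, THEN conjunct2, THEN conjunct1, rule_format]

lemmas P_symmetric = P_rules[THEN conjunct2, THEN conjunct2, THEN conjunct2, THEN conjunct1, rule_format]

lemmas P_P = P_rules[THEN conjunct2, THEN conjunct2, THEN conjunct2, THEN conjunct2, rule_format]

lemmas P_UNIV = pvm_unfolded[THEN conjunct2, THEN conjunct1, rule_format]

lemmas P_additive = pvm_unfolded[THEN conjunct2, THEN conjunct2, rule_format]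

lemma P_P_inner:
  "A \<in> sets borel \<Longrightarrow> B \<in> sets borel \<Longrightarrow> f \<in> L2 M \<Longrightarrow> g \<in> L2 M \<Longrightarrow>
    l2_inner M (P A (P B f)) g = l2_inner M (P (A \<inter> B) f) g"
  by (intro l2_inner_cong_left P_P) auto

lemma P_UNIV_inner: "f \<in> L2 M \<Longrightarrow> g \<in> L2 M \<Longrightarrow> l2_inner M (P UNIV f) g = l2_inner M f g"
  by (intro l2_inner_cong_left P_UNIV) auto

lemma P_add_inner:
  assumes "A \<in> sets borel" "f \<in> L2 M" "g \<in> L2 M" "h \<in> L2 M"
  shows "l2_inner M (P A (\<lambda>x. f x + g x)) h = l2_inner M (P A f) h + l2_inner M (P A g) h"
  using assms by (simp add: P_symmetric)

lemma P_diff_inner: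
  assumes "A \<in> sets borel" "f \<in> L2 M" "g \<in> L2 M" "h \<in> L2 M"
  shows "l2_inner M (P A (\<lambda>x. f x - g x)) h = l2_inner M (P A f) h - l2_inner M (P A g) h"
  using assms by (simp add: P_symmetric)

lemma P_inner_self:
  assumes "A \<in> sets borel" "f \<in> L2 M"
  shows "l2_inner M (P A f) f = (l2_norm M (P A f))\<^sup>2"
  using P_P_inner[of A A f f] P_symmetric[of A "P A f" f] assms by (simp add: l2_norm_power2)

lemma P_sums:
  assumes "range A \<subseteq> sets borel" "disjoint_family A" "f \<in> L2 M" "g \<in> L2 M"
  shows "(\<lambda>n. l2_inner M (P (A n) f) g) sums l2_inner M (P (\<Union>n. A n) f) g"
  unfolding sums_def
proof (rule LIM_zero_cancel, rule Lim_null_comparison)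
  have A: "A n \<in> sets borel" "(\<Union>n. A n) \<in> sets borel" for n
    using assms(1) by auto
  let ?r = "\<lambda>n x. P (\<Union>n. A n) f x - (\<Sum>i<n. P (A i) f x)"
  have "(\<lambda>n. l2_norm M (?r n)) \<longlonglongrightarrow> 0"
    using assms by (intro P_additive)
  then show "(\<lambda>n. l2_norm M (?r n) * l2_norm M g) \<longlonglongrightarrow> 0"
    by (rule tendsto_mult_left_zero)
  have "\<bar>(\<Sum>i<n. l2_inner M (P (A i) f) g) - l2_inner M (P (\<Union>n. A n) f) g\<bar>
      \<le> l2_norm M (?r n) * l2_norm M g" for n
  proof -
    have "l2_inner M (?r n) g = l2_inner M (P (\<Union>n. A n) f) g - (\<Sum>i<n. l2_inner M (P (A i) f) g)"
      using A assms by (simp add: l2_inner_sum_left)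
    moreover have "\<bar>l2_inner M (?r n) g\<bar> \<le> l2_norm M (?r n) * l2_norm M g"
      using A assms by (intro l2_cauchy_schwarz) auto
    ultimately show ?thesis
      by linarith
  qed
  then show "\<forall>\<^sub>F n in sequentially.
      norm ((\<Sum>i<n. l2_inner M (P (A i) f) g) - l2_inner M (P (\<Union>n. A n) f) g)
        \<le> l2_norm M (?r n) * l2_norm M g"
    by simp
qed

text \<open>Vanishing on the empty set is not part of the definition. It follows from additivity for
  the constant family of empty sets, as a constant summable series is zero.\<close>

lemma P_empty_inner:
  assumes "f \<in> L2 M" "g \<in> L2 M"
  shows "l2_inner M (P {} f) g = 0"
proof -
  have "(\<lambda>n::nat. l2_inner M (P {} f) g) sums l2_inner M (P {} f) g"
    using P_sums[of "\<lambda>_. {}" f g] assms by (simp add: disjoint_family_on_def)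
  then show ?thesis
    using sums_summable summable_const_iff by blast
qed

text \<open>\<open>measure_of\<close> assigns the intended values only if the set function is a
  measure, so positivity and countable additivity have to be established before any moment can be
  used.\<close>

lemma
  assumes f: "f \<in> L2 M"
  shows sets_scalar_measure: "sets (scalar_spectral_measure M P f) = sets borel"
    and emeasure_scalar_measure: "A \<in> sets borel \<Longrightarrow>
      emeasure (scalar_spectral_measure M P f) A = ennreal (l2_inner M (P A f) f)"
proof -
  let ?m = "\<lambda>A. ennreal (l2_inner M (P A f) f)"
  show sets: "sets (scalar_spectral_measure M P f) = sets borel"
    unfolding scalar_spectral_measure_def
    by (metis sets.sets_measure_of_eq space_borel)
  have nonneg: "0 \<le> l2_inner M (P A f) f" if "A \<in> sets borel" for A
    using P_inner_self[OF that f] by simp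
  have "countably_additive (sets borel) ?m"
    unfolding countably_additive_def
  proof (intro allI impI)
    fix A :: "nat \<Rightarrow> real set" assume A: "range A \<subseteq> sets borel" "disjoint_family A"
    show "(\<Sum>i. ?m (A i)) = ?m (\<Union>i. A i)"
    proof (rule suminf_ennreal_eq)
      show "0 \<le> l2_inner M (P (A i) f) f" for i
        using A(1) by (intro nonneg) auto
      show "(\<lambda>i. l2_inner M (P (A i) f) f) sums l2_inner M (P (\<Union>i. A i) f) f"
        using A f f by (rule P_sums)
    qed
  qed
  moreover have "positive (sets borel) ?m"
    using f by (simp add: positive_def P_empty_inner)
  ultimately show "emeasure (scalar_spectral_measure M P f) A = ?m A" if "A \<in> sets borel"
    using that sets by (intro emeasure_measure_of[OF scalar_spectral_measure_def]) simp_all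
qed

lemma space_scalar_measure: "f \<in> L2 M \<Longrightarrow> space (scalar_spectral_measure M P f) = UNIV"
  using sets_eq_imp_space_eq[OF sets_scalar_measure] by simp

lemma scalar_measure_eqI:
  assumes "f \<in> L2 M" "g \<in> L2 M"
    and "\<And>A. A \<in> sets borel \<Longrightarrow> l2_inner M (P A f) f = l2_inner M (P A g) g"
  shows "scalar_spectral_measure M P f = scalar_spectral_measure M P g"
  using assms by (intro measure_eqI) (simp_all add: sets_scalar_measure emeasure_scalar_measure)

lemma finite_scalar_measure:
  assumes "f \<in> L2 M"
  shows "finite_measure (scalar_spectral_measure M P f)"
    and "measure (scalar_spectral_measure M P f) UNIV = (l2_norm M f)\<^sup>2"
  using assms
  by (auto intro!: finite_measureI
      simp: space_scalar_measure emeasure_scalar_measure measure_def P_UNIV_inner l2_norm_power2)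

section \<open>Symmetry and dense domain of the square root\<close>

lemmas S_unfolded = nonneg_self_adjoint[unfolded nonneg_self_adjoint_def]

lemmas S_operator = S_unfolded[THEN conjunct1, unfolded l2_operator_def]

lemmas S_dense = S_unfolded[THEN conjunct2, THEN conjunct1]

lemmas S_self_adjoint = S_unfolded[THEN conjunct2, THEN conjunct2, THEN conjunct1]

lemma S_nonneg: "(f, u) \<in> S \<Longrightarrow> 0 \<le> l2_inner M u f"
  using S_unfolded by blast

lemma S_L2: "(f, u) \<in> S \<Longrightarrow> f \<in> L2 M" "(f, u) \<in> S \<Longrightarrow> u \<in> L2 M"
  using S_operator[THEN conjunct1] by auto

lemma domain_L2: "f \<in> Domain S \<Longrightarrow> f \<in> L2 M"
  by (erule DomainE) (rule S_L2)

lemmas S_lincomb = S_operator[THEN conjunct2, THEN conjunct2, THEN conjunct1, rule_format]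

lemma S_symmetric:
  assumes "(f, u) \<in> S" "(g, v) \<in> S"
  shows "l2_inner M u g = l2_inner M f v"
proof -
  have "(g, v) \<in> l2_adjoint M S"
    using assms(2) by (simp only: S_self_adjoint)
  then show ?thesis
    using assms(1) unfolding l2_adjoint_def by blast
qed

text \<open>A \<open>k\<close> in the domain closer to \<open>u\<close> than the norm of
  \<open>u\<close> would give
  \<open>l2_norm M u ^ 2 = l2_inner M u (u - k) < l2_norm M u ^ 2\<close>.\<close>

lemma null_if_orthogonal_to_domain:
  assumes u: "u \<in> L2 M" and orth: "\<And>k. k \<in> Domain S \<Longrightarrow> l2_inner M u k = 0"
  shows "l2_norm M u = 0"
proof (rule ccontr)
  assume "l2_norm M u \<noteq> 0"
  then have "0 < l2_norm M u"
    by (simp add: less_le)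
  then obtain k where k: "k \<in> Domain S" "l2_norm M (\<lambda>x. u x - k x) < l2_norm M u"
    using u S_dense unfolding l2_dense_def by blast
  then have "k \<in> L2 M"
    by (intro domain_L2)
  have "(l2_norm M u)\<^sup>2 = l2_inner M u (\<lambda>x. u x - k x)"
    using u k orth \<open>k \<in> L2 M\<close> by (simp add: l2_norm_power2)
  also have "\<dots> \<le> l2_norm M u * l2_norm M (\<lambda>x. u x - k x)"
    using l2_cauchy_schwarz[of u M "\<lambda>x. u x - k x"] u \<open>k \<in> L2 M\<close> by simp
  also have "\<dots> < l2_norm M u * l2_norm M u"
    using k \<open>0 < l2_norm M u\<close> by simp
  finally show False
    by (simp add: power2_eq_square)
qed

lemma S_quadratic_form:
  "(f, u) \<in> S \<Longrightarrow> l2_inner M u f = (LINT t|scalar_spectral_measure M P f. t)"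
  using spectral unfolding spectral_measure_of_def by blast

section \<open>The Paley-Wiener space for a fixed cut-off\<close>

context
  fixes \<omega> :: real
  assumes omega_pos: "0 < \<omega>"
begin

abbreviation (input) PW :: "('a \<Rightarrow> real) set" where
  "PW \<equiv> paley_wiener M P \<omega>"

abbreviation (input) Q :: "('a \<Rightarrow> real) \<Rightarrow> ('a \<Rightarrow> real)" where
  "Q \<equiv> P {0..\<omega>}"

text \<open>Idempotence of the projector turns membership in its range into a fixed point
  condition.\<close>

lemma PW_iff: "f \<in> PW \<longleftrightarrow> f \<in> L2 M \<and> l2_eq M f (Q f)"
proof
  assume "f \<in> PW"
  then obtain g where f: "f \<in> L2 M" and g: "g \<in> L2 M" and eq: "l2_eq M f (Q g)"
    by (auto simp: paley_wiener_def)
  have "l2_eq M (Q f) (Q (Q g))" "l2_eq M (Q (Q g)) (Q g)"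
    using P_cong[OF _ f _ eq] P_P[of "{0..\<omega>}" g "{0..\<omega>}"] f g by auto
  with eq have "l2_eq M f (Q f)"
    unfolding l2_eq_def by eventually_elim simp
  with f show "f \<in> L2 M \<and> l2_eq M f (Q f)" ..
next
  assume "f \<in> L2 M \<and> l2_eq M f (Q f)"
  then show "f \<in> PW"
    unfolding paley_wiener_def by blast
qed

lemma PW_L2: "f \<in> PW \<Longrightarrow> f \<in> L2 M"
  by (simp add: PW_iff)

lemma Q_in_PW: "f \<in> L2 M \<Longrightarrow> Q f \<in> PW"
  unfolding paley_wiener_def l2_eq_def by (intro CollectI conjI P_in bexI[of _ f]) auto

lemma Q_inner: "f \<in> PW \<Longrightarrow> k \<in> L2 M \<Longrightarrow> l2_inner M (Q f) k = l2_inner M f k"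
  by (rule l2_inner_cong_left[symmetric]) (auto simp: PW_iff)

lemma PW_subspace: "l2_subspace M PW"
proof
  show "f \<in> L2 M" if "f \<in> PW" for f
    using that by (rule PW_L2)
  show lincomb: "(\<lambda>x. a * f x + b * g x) \<in> PW" if "f \<in> PW" "g \<in> PW" for f g a b
  proof -
    have "l2_eq M (Q (\<lambda>x. a * f x + b * g x)) (\<lambda>x. a * Q f x + b * Q g x)"
      using that by (intro P_lincomb) (auto simp: PW_iff)
    moreover have "l2_eq M f (Q f)" "l2_eq M g (Q g)"
      using that by (auto simp: PW_iff)
    ultimately have "l2_eq M (\<lambda>x. a * f x + b * g x) (Q (\<lambda>x. a * f x + b * g x))"
      unfolding l2_eq_def by eventually_elim simp
    then show ?thesis
      using that by (simp add: PW_iff L2_lincomb)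
  qed
  show "(\<lambda>x. 0) \<in> PW"
    using lincomb[OF Q_in_PW Q_in_PW, of "\<lambda>x. 0" "\<lambda>x. 0" 0 0] by simp
qed

text \<open>The projectors of \<open>{0..\<omega>}\<close> and of its complement compose to that of
  the empty set.\<close>

lemma scalar_measure_support:
  assumes "f \<in> PW"
  shows "AE t in scalar_spectral_measure M P f. t \<in> {0..\<omega>}"
proof (rule AE_I)
  have f: "f \<in> L2 M"
    using assms by (rule PW_L2)
  have "l2_inner M (P (- {0..\<omega>}) f) f = l2_inner M (P (- {0..\<omega>}) (Q f)) f"
    using assms f Q_inner[OF assms, of "P (- {0..\<omega>}) f"] by (simp add: P_symmetric)
  also have "\<dots> = 0"
    using f by (simp add: P_P_inner P_empty_inner)
  finally show "emeasure (scalar_spectral_measure M P f) (- {0..\<omega>}) = 0"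
    using f by (simp add: emeasure_scalar_measure)
  show "- {0..\<omega>} \<in> sets (scalar_spectral_measure M P f)"
    using f by (simp add: sets_scalar_measure)
qed auto

lemma integrable_power_scalar_measure:
  assumes "f \<in> PW"
  shows "integrable (scalar_spectral_measure M P f) (\<lambda>t. t ^ n)"
proof -
  interpret finite_measure "scalar_spectral_measure M P f"
    using assms by (intro finite_scalar_measure PW_L2)
  have "AE t in scalar_spectral_measure M P f. norm (t ^ n) \<le> \<omega> ^ n"
    using scalar_measure_support[OF assms] by eventually_elim (auto intro: power_mono)
  moreover have "(\<lambda>t. t ^ n) \<in> borel_measurable (scalar_spectral_measure M P f)"
    by (simp add: measurable_cong_sets[OF sets_scalar_measure[OF PW_L2[OF assms]] refl])
  ultimately show ?thesis
    by (rule integrable_const_bound)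
qed

text \<open>The spectral measure of \<open>f\<close> is finite and lives on
  \<open>{0..\<omega>}\<close>, so its second moment is finite, which is the description of the
  domain.\<close>

lemma PW_subset_domain: "PW \<subseteq> Domain S"
proof
  fix f assume "f \<in> PW"
  then have "f \<in> {f \<in> L2 M. integrable (scalar_spectral_measure M P f) (\<lambda>t. t\<^sup>2)}"
    by (simp add: integrable_power_scalar_measure PW_L2)
  then show "f \<in> Domain S"
    using spectral unfolding spectral_measure_of_def by (simp only:)
qed

lemma S_form_bounds:
  assumes "f \<in> PW" "(f, u) \<in> S"
  shows "0 \<le> l2_inner M u f" "l2_inner M u f \<le> \<omega> * (l2_norm M f)\<^sup>2"
proof -
  let ?\<mu> = "scalar_spectral_measure M P f"
  have f: "f \<in> L2 M"
    using assms(1) by (rule PW_L2)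
  interpret finite_measure ?\<mu>
    using f by (rule finite_scalar_measure)
  show "0 \<le> l2_inner M u f"
    using assms(2) by (rule S_nonneg)
  have "(LINT t|?\<mu>. t) \<le> (LINT t|?\<mu>. \<omega>)"
    using scalar_measure_support[OF assms(1)] integrable_power_scalar_measure[OF assms(1), of 1]
    by (intro integral_mono_AE) auto
  also have "\<dots> = \<omega> * (l2_norm M f)\<^sup>2"
    using f by (simp add: space_scalar_measure finite_scalar_measure(2))
  finally show "l2_inner M u f \<le> \<omega> * (l2_norm M f)\<^sup>2"
    by (simp add: S_quadratic_form[OF assms(2)])
qed

text \<open>For \<open>f\<close> in the range of the projector and \<open>g\<close> in its kernel, \<open>f + g\<close> and \<open>f - g\<close> have the
  same scalar spectral measure, so that polarization gives \<open>\<langle>S f, g\<rangle> = 0\<close>.\<close>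

lemma S_preserves_PW:
  assumes f: "f \<in> PW" and fu: "(f, u) \<in> S"
  shows "u \<in> PW"
proof -
  have fL: "f \<in> L2 M" and uL: "u \<in> L2 M"
    using S_L2[OF fu] .
  have "l2_inner M (\<lambda>x. u x - Q u x) k = 0" if "k \<in> Domain S" for k
  proof -
    obtain v where kv: "(k, v) \<in> S"
      using \<open>k \<in> Domain S\<close> by auto
    then have kL: "k \<in> L2 M"
      by (rule S_L2)
    \<comment> \<open>\<open>Q k\<close> lies in the domain because the whole Paley-Wiener space
      does. Hence so does \<open>g = k - Q k\<close>, which the projector annihilates.\<close>
    obtain v' where Qkv: "(Q k, v') \<in> S"
      using PW_subset_domain Q_in_PW[OF kL] by blast
    define g where "g = (\<lambda>x. k x - Q k x)"
    define w where "w = (\<lambda>x. v x - v' x)"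
    have gw: "(g, w) \<in> S"
      using S_lincomb[OF kv Qkv, of 1 "-1"] by (simp add: g_def w_def)
    have gL: "g \<in> L2 M" and wL: "w \<in> L2 M"
      using S_L2[OF gw] .
    have plus: "((\<lambda>x. f x + g x), (\<lambda>x. u x + w x)) \<in> S"
      using S_lincomb[OF fu gw, of 1 1] by simp
    have minus: "((\<lambda>x. f x - g x), (\<lambda>x. u x - w x)) \<in> S"
      using S_lincomb[OF fu gw, of 1 "-1"] by simp
    have Qg: "l2_inner M h (Q g) = 0" if "h \<in> L2 M" for h
    proof -
      have "l2_inner M (Q g) h = 0"
        using that kL by (simp add: g_def P_diff_inner P_P_inner)
      then show ?thesis
        by (simp add: l2_inner_commute)
    qed
    \<comment> \<open>\<open>P A\<close> commutes with \<open>Q\<close>, which fixes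
      \<open>f\<close> and annihilates \<open>g\<close>. The mixed terms therefore vanish and the
      sign of \<open>g\<close> is invisible to the scalar measures.\<close>
    have cross: "l2_inner M (P A f) g = 0" if "A \<in> sets borel" for A
    proof -
      have "l2_inner M (P A f) g = l2_inner M (P A (Q f)) g"
        using that fL gL f Q_inner[OF f, of "P A g"] by (simp add: P_symmetric)
      also have "\<dots> = l2_inner M (Q (P A f)) g"
        using that fL gL by (simp add: P_P_inner Int_commute)
      also have "\<dots> = 0"
        using that fL gL by (simp add: P_symmetric[of "{0..\<omega>}" "P A f"] Qg)
      finally show ?thesis .
    qed
    have "scalar_spectral_measure M P (\<lambda>x. f x + g x) = scalar_spectral_measure M P (\<lambda>x. f x - g x)"
    proof (rule scalar_measure_eqI)
      fix A :: "real set" assume A: "A \<in> sets borel"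
      have "l2_inner M (P A g) f = 0"
        using cross[OF A] P_symmetric[OF A gL fL] l2_inner_commute[of M g "P A f"] by simp
      then show "l2_inner M (P A (\<lambda>x. f x + g x)) (\<lambda>x. f x + g x)
          = l2_inner M (P A (\<lambda>x. f x - g x)) (\<lambda>x. f x - g x)"
        using cross[OF A] A fL gL by (simp add: P_add_inner P_diff_inner)
    qed (use fL gL in auto)
    then have "l2_inner M (\<lambda>x. u x + w x) (\<lambda>x. f x + g x) = l2_inner M (\<lambda>x. u x - w x) (\<lambda>x. f x - g x)"
      by (simp add: S_quadratic_form[OF plus] S_quadratic_form[OF minus])
    \<comment> \<open>Equal first moments leave only the cross terms; by symmetry of
      \<open>S\<close> both of them are the same number, hence zero.\<close>
    then have "l2_inner M u g + l2_inner M w f = 0"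
      using uL wL fL gL by simp
    moreover have "l2_inner M w f = l2_inner M u g"
      using S_symmetric[OF gw fu] by (simp add: l2_inner_commute)
    ultimately have "l2_inner M u k = l2_inner M u (Q k)"
      using uL kL by (simp add: g_def)
    then show ?thesis
      using uL kL by (simp add: P_symmetric)
  qed
  then have "l2_norm M (\<lambda>x. u x - Q u x) = 0"
    using uL by (intro null_if_orthogonal_to_domain) auto
  then show ?thesis
    using uL by (simp add: PW_iff l2_eq_iff_norm)
qed

lemma op_app_S:
  assumes "f \<in> PW"
  shows "(f, op_app S f) \<in> S"
proof -
  have "\<exists>u. (f, u) \<in> S"
    using assms PW_subset_domain by blast
  then show ?thesis
    unfolding op_app_def by (rule someI_ex)
qed

text \<open>Gives access to the Poincare inequality, which is assumed on the domain of
  \<open>L = S O S\<close> and not on that of the form.\<close>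

lemma PW_in_domain_square: "f \<in> PW \<Longrightarrow> f \<in> Domain (S O S)"
  using op_app_S S_preserves_PW by blast

text \<open>The spectral data bound the form of \<open>S\<close>, not the norm of
  \<open>S f\<close>. As \<open>S\<close> maps the space symmetrically into itself,
  \<open>symmetric_operator_norm_le\<close> converts the form bound into the norm bound.\<close>

lemma bernstein:
  assumes "f \<in> PW"
  shows "l2_norm M (op_app S f) \<le> \<omega> * l2_norm M f"
proof -
  interpret l2_subspace M PW
    by (rule PW_subspace)
  show ?thesis
  proof (rule symmetric_operator_norm_le[where R = "op_app S"])
    show "op_app S f \<in> PW" if "f \<in> PW" for f
      using S_preserves_PW op_app_S that by blast
    show "l2_inner M (op_app S f) g = l2_inner M f (op_app S g)" if "f \<in> PW" "g \<in> PW" for f g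
      using S_symmetric op_app_S that by blast
    show "\<bar>l2_inner M (op_app S f) f\<bar> \<le> \<omega> * (l2_norm M f)\<^sup>2" if "f \<in> PW" for f
      using S_form_bounds[OF that op_app_S[OF that]] by simp
  qed (use assms omega_pos in auto)
qed

lemma root_form_le:
  assumes "f \<in> PW"
  shows "root_form M S f f \<le> \<omega>\<^sup>2 * (l2_norm M f)\<^sup>2"
  using power_mono[OF bernstein[OF assms], of 2]
  by (simp add: root_form_def power_mult_distrib l2_norm_power2)

text \<open>On the Paley-Wiener space the form norm is equivalent to the norm, so that the closedness of
  the form replaces the completeness of \<open>L\<^sub>2\<close>.\<close>

lemma PW_hilbert:
  assumes "dirichlet_form M (Domain S) (root_form M S)"
  shows "l2_hilbert M PW"
proof -
  interpret l2_subspace M PW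
    by (rule PW_subspace)
  show ?thesis
  proof unfold_locales
    fix s :: "nat \<Rightarrow> 'a \<Rightarrow> real"
    assume s: "range s \<subseteq> PW"
      and cauchy: "\<And>e. e > 0 \<Longrightarrow> \<exists>N. \<forall>m\<ge>N. \<forall>n\<ge>N. l2_norm M (\<lambda>x. s m x - s n x) < e"
    have s_in: "s n \<in> PW" for n
      using s by auto
    have "\<exists>N. \<forall>m\<ge>N. \<forall>n\<ge>N. form_norm2 M (root_form M S) (\<lambda>x. s m x - s n x) < e" if "0 < e" for e
    proof -
      \<comment> \<open>Solves \<open>(\<omega>\<^sup>2 + 1) * d\<^sup>2 = e\<close>, as the squared
        form norm is at most \<open>\<omega>\<^sup>2 + 1\<close> times the squared norm.\<close>
      define d where "d = sqrt (e / (\<omega>\<^sup>2 + 1))"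
      have "0 < \<omega>\<^sup>2 + 1"
        by (simp add: add_nonneg_pos)
      then have d: "0 < d" "(\<omega>\<^sup>2 + 1) * d\<^sup>2 = e"
        using that by (auto simp: d_def)
      obtain N where N: "\<And>m n. m \<ge> N \<Longrightarrow> n \<ge> N \<Longrightarrow> l2_norm M (\<lambda>x. s m x - s n x) < d"
        using cauchy[OF d(1)] by blast
      have "form_norm2 M (root_form M S) (\<lambda>x. s m x - s n x) < e" if "m \<ge> N" "n \<ge> N" for m n
      proof -
        have "form_norm2 M (root_form M S) (\<lambda>x. s m x - s n x)
            \<le> (\<omega>\<^sup>2 + 1) * (l2_norm M (\<lambda>x. s m x - s n x))\<^sup>2"
          using root_form_le[of "\<lambda>x. s m x - s n x"] s_in
          by (simp add: form_norm2_def distrib_right)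
        also have "\<dots> < (\<omega>\<^sup>2 + 1) * d\<^sup>2"
          using N[OF that] \<open>0 < \<omega>\<^sup>2 + 1\<close> by (intro mult_strict_left_mono power_strict_mono) auto
        finally show ?thesis
          using d by simp
      qed
      then show ?thesis by blast
    qed
    moreover have "range s \<subseteq> Domain S"
      using s PW_subset_domain by blast
    ultimately obtain f where f: "f \<in> Domain S"
      and lim: "(\<lambda>n. form_norm2 M (root_form M S) (\<lambda>x. s n x - f x)) \<longlonglongrightarrow> 0"
      using assms unfolding dirichlet_form_def by blast
    have fL: "f \<in> L2 M"
      using f by (rule domain_L2)
    have "(\<lambda>n. (l2_norm M (\<lambda>x. s n x - f x))\<^sup>2) \<longlonglongrightarrow> 0"
      by (rule Lim_null_comparison[OF _ lim]) (simp add: form_norm2_def root_form_def)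
    then have norm_lim: "(\<lambda>n. l2_norm M (\<lambda>x. s n x - f x)) \<longlonglongrightarrow> 0"
      by simp
    \<comment> \<open>Closedness puts the limit only into the domain of \<open>S\<close>. That it is
      band-limited follows because all \<open>s n\<close> are orthogonal to the range of
      \<open>1 - Q\<close> and orthogonality survives norm limits.\<close>
    have orth: "l2_inner M f (\<lambda>x. k x - Q k x) = 0" if k: "k \<in> L2 M" for k
    proof -
      define g where "g = (\<lambda>x. k x - Q k x)"
      have g: "g \<in> L2 M"
        using k by (simp add: g_def)
      have "l2_inner M (s n) g = 0" for n
        using Q_inner[OF s_in, of k n] s_in k by (simp add: g_def P_symmetric)
      then have "\<bar>l2_inner M f g\<bar> \<le> l2_norm M (\<lambda>x. s n x - f x) * l2_norm M g" for n
        using l2_cauchy_schwarz[of "\<lambda>x. s n x - f x" M g] s_in fL g by simp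
      moreover have "(\<lambda>n. l2_norm M (\<lambda>x. s n x - f x) * l2_norm M g) \<longlonglongrightarrow> 0"
        using norm_lim by (rule tendsto_mult_left_zero)
      ultimately have "\<bar>l2_inner M f g\<bar> \<le> 0"
        by (intro tendsto_lowerbound[of _ 0 sequentially "\<bar>l2_inner M f g\<bar>"]) auto
      then show ?thesis
        by (simp add: g_def)
    qed
    have "l2_inner M (\<lambda>x. f x - Q f x) k = 0" if k: "k \<in> L2 M" for k
      using orth[OF k] k fL by (simp add: P_symmetric)
    from this[of "\<lambda>x. f x - Q f x"] have "l2_norm M (\<lambda>x. f x - Q f x) = 0"
      using fL unfolding l2_norm_def by (simp only: L2_diff P_in atLeastAtMost_borel real_sqrt_zero)
    then have "f \<in> PW"
      unfolding PW_iff using fL by (simp add: l2_eq_iff_norm)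
    with norm_lim show "\<exists>f\<in>PW. (\<lambda>n. l2_norm M (\<lambda>x. s n x - f x)) \<longlonglongrightarrow> 0"
      by blast
  qed
qed

end

end

section \<open>Metric lattices\<close>

text \<open>Local compactness supplies one small ball of finite measure about \<open>x\<close>;
  repeated doubling reaches every radius.\<close>

lemma doubling_ball_finite:
  fixes M :: "'a::metric_space measure"
  assumes "locally_compact_space (euclidean :: 'a topology)" "radon_measure M"
    and D: "doubling_measure M D"
  shows "emeasure M (ball x r) < \<infinity>"
proof -
  obtain U K where UK: "open U" "compact K" "x \<in> U" "U \<subseteq> K"
    using assms(1) unfolding locally_compact_space_def by simp metis
  obtain e where e: "0 < e" "ball x e \<subseteq> U"
    using UK openE by blast
  have sets: "sets M = sets borel" and K: "emeasure M K < \<infinity>"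
    using assms(2) UK by (auto simp: radon_measure_def)
  have "K \<in> sets M"
    using UK sets by (simp add: compact_imp_closed)
  then have "emeasure M (ball x e) \<le> emeasure M K"
    using e UK by (intro emeasure_mono) auto
  then have start: "emeasure M (ball x e) < \<infinity>"
    using K by order
  have doubled: "emeasure M (ball x (2 ^ n * e)) < \<infinity>" for n
  proof (induction n)
    case (Suc n)
    have "emeasure M (ball x (2 ^ Suc n * e)) \<le> ennreal (2 powr D) * emeasure M (ball x (2 ^ n * e))"
      using D e unfolding doubling_measure_def by (auto simp: mult.assoc)
    also have "\<dots> < \<infinity>"
      using Suc by (simp add: ennreal_mult_less_top)
    finally show ?case .
  qed (use start in simp)
  obtain n where "r / e < 2 ^ n"
    using real_arch_pow[of 2 "r / e"] by auto
  then have "ball x r \<subseteq> ball x (2 ^ n * e)"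
    using e by (intro subset_ball) (simp add: field_simps)
  then have "emeasure M (ball x r) \<le> emeasure M (ball x (2 ^ n * e))"
    using sets by (intro emeasure_mono) auto
  then show ?thesis
    using doubled[of n] by order
qed

lemma doubling_ball_pos:
  assumes "doubling_measure M D" "0 < r"
  shows "0 < emeasure M (ball x r)"
proof -
  have "0 < emeasure M (ball x (2 * (r / 2)))"
    using assms unfolding doubling_measure_def by (meson half_gt_zero)
  then show ?thesis by simp
qed

text \<open>The disjoint balls of radius \<open>\<rho> / 2\<close> contain distinct points of a
  countable dense set.\<close>

lemma metric_lattice_countable:
  fixes X :: "'a::metric_space set"
  assumes "separable_space (euclidean :: 'a topology)" "metric_lattice N \<rho> X" "0 < \<rho>"
  shows "countable X"
proof -
  obtain C :: "'a set" where C: "countable C" "closure C = UNIV"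
    using assms(1) by (auto simp: separable_space_def)
  have "\<exists>c\<in>C. c \<in> ball x (\<rho> / 2)" for x
    using C(2) closure_approachable[of x C] \<open>0 < \<rho>\<close>
    by (metis UNIV_I dist_commute half_gt_zero mem_ball)
  then obtain c where c: "\<And>x. c x \<in> C" "\<And>x. c x \<in> ball x (\<rho> / 2)"
    by metis
  have "inj_on c X"
    using assms(2) c(2) unfolding metric_lattice_def inj_on_def by (metis IntI empty_iff)
  moreover have "countable (c ` X)"
    using c(1) C(1) by (meson countable_subset image_subsetI)
  ultimately show ?thesis
    using countable_image_inj_on by blast
qed

context
  fixes G :: "'a::metric_space measure" and N :: nat and \<rho> :: real and X :: "'a set"
  assumes sets_G: "sets G = sets borel" and finite_G: "finite_measure G"
    and lattice: "metric_lattice N \<rho> X"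
begin

text \<open>Integrate the pointwise multiplicity bound for the indicators of the balls.
  \<open>G\<close> stays general because both the density of \<open>f\<^sup>2\<close> and the energy
  measure of \<open>f\<close> are inserted.\<close>

lemma lattice_sum_le:
  assumes "finite F" "F \<subseteq> X"
  shows "(\<Sum>x\<in>F. measure G (ball x \<rho>)) \<le> real N * measure G UNIV"
proof -
  interpret finite_measure G by (rule finite_G)
  have space: "space G = UNIV"
    using sets_eq_imp_space_eq[OF sets_G] by simp
  have ball: "ball x \<rho> \<in> sets G" for x
    by (simp add: sets_G)
  have le: "(\<Sum>x\<in>F. indicat_real (ball x \<rho>) y) \<le> real N" for y
  proof -
    have "(\<Sum>x\<in>F. indicat_real (ball x \<rho>) y) = real (card {x \<in> F. y \<in> ball x \<rho>})"
      using assms(1) by (simp add: indicator_def sum.If_cases Int_def)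
    also have "card {x \<in> F. y \<in> ball x \<rho>} \<le> card {x \<in> X. y \<in> ball x \<rho>}"
      using assms(2) lattice by (intro card_mono) (auto simp: metric_lattice_def)
    also have "\<dots> \<le> N"
      using lattice unfolding metric_lattice_def by blast
    finally show ?thesis by simp
  qed
  have "(\<Sum>x\<in>F. measure G (ball x \<rho>)) = (LINT y|G. (\<Sum>x\<in>F. indicator (ball x \<rho>) y))"
    using ball by (simp add: Bochner_Integration.integral_sum emeasure_eq_measure)
  also have "\<dots> \<le> (LINT y|G. real N)"
    using ball le by (intro integral_mono) (auto intro!: Bochner_Integration.integrable_sum simp: emeasure_eq_measure)
  also have "\<dots> = real N * measure G UNIV"
    by (simp add: space)
  finally show ?thesis .
qed

lemma lattice_summable: "(\<lambda>x. measure G (ball x \<rho>)) summable_on X"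
  using lattice_sum_le by (intro nonneg_bdd_above_summable_on) (auto intro!: bdd_aboveI2)

lemma lattice_infsum_le: "(\<Sum>\<^sub>\<infinity>x\<in>X. measure G (ball x \<rho>)) \<le> real N * measure G UNIV"
  using lattice_summable lattice_sum_le by (intro infsum_le_finite_sums) auto

text \<open>Finite unions of lattice balls increase to the whole space, so continuity from below and
  finite subadditivity suffice; countability provides the exhaustion.\<close>

lemma lattice_infsum_ge:
  assumes "countable X"
  shows "measure G UNIV \<le> (\<Sum>\<^sub>\<infinity>x\<in>X. measure G (ball x \<rho>))"
proof -
  interpret finite_measure G by (rule finite_G)
  have ball: "ball x \<rho> \<in> sets G" for x
    by (simp add: sets_G)
  have cover: "(\<Union>x\<in>X. ball x \<rho>) = UNIV"
    using lattice by (simp add: metric_lattice_def)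
  then have "X \<noteq> {}"
    by auto
  \<comment> \<open>\<open>from_nat_into\<close> repeats values when \<open>X\<close> is finite, so
    finite and infinite lattices are treated alike.\<close>
  define F where "F = (\<lambda>n. from_nat_into X ` {..n::nat})"
  have F: "finite (F n)" "F n \<subseteq> X" for n
    using from_nat_into[OF \<open>X \<noteq> {}\<close>] by (auto simp: F_def)
  define U where "U = (\<lambda>n. \<Union>x\<in>F n. ball x \<rho>)"
  have "incseq U"
    unfolding U_def F_def incseq_def by (auto, meson le_trans atMost_iff)
  moreover have "range U \<subseteq> sets G"
    using ball F(1) by (auto simp: U_def)
  ultimately have "(\<lambda>n. measure G (U n)) \<longlonglongrightarrow> measure G (\<Union>n. U n)"
    by (rule finite_Lim_measure_incseq[rotated])
  moreover have "(\<Union>n. U n) = UNIV"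
  proof -
    have "(\<Union>n. F n) = X"
      unfolding F_def using range_from_nat_into[OF \<open>X \<noteq> {}\<close> assms] by blast
    then show ?thesis
      using cover by (auto simp: U_def)
  qed
  moreover have "measure G (U n) \<le> (\<Sum>\<^sub>\<infinity>x\<in>X. measure G (ball x \<rho>))" for n
  proof -
    have "measure G (U n) \<le> (\<Sum>x\<in>F n. measure G (ball x \<rho>))"
      unfolding U_def using F(1) ball by (intro measure_UNION_le) auto
    also have "\<dots> \<le> (\<Sum>\<^sub>\<infinity>x\<in>X. measure G (ball x \<rho>))"
      using F lattice_summable by (intro finite_sum_le_infsum) auto
    finally show ?thesis .
  qed
  ultimately show ?thesis
    by (auto intro: LIMSEQ_le_const2)
qed

end

section \<open>Averages over balls\<close>

context
  fixes M :: "'a::metric_space measure" and x :: 'a and r :: real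
  assumes sets_M: "sets M = sets borel"
    and ball_finite: "emeasure M (ball x r) < \<infinity>" and ball_pos: "0 < emeasure M (ball x r)"
begin

lemma ball_in_sets: "ball x r \<in> sets M"
  by (simp add: sets_M)

lemma measure_ball_pos: "0 < measure M (ball x r)"
  using ball_finite ball_pos by (simp add: measure_def enn2real_positive_iff)

lemma xi_in_L2: "xi M r x \<in> L2 M"
proof -
  have "xi M r x \<in> borel_measurable M"
    unfolding xi_def using ball_in_sets by measurable
  moreover have "integrable M (\<lambda>y. (measure M (ball x r) powr (-1/2))\<^sup>2 * indicat_real (ball x r) y)"
    using ball_in_sets ball_finite by simp
  moreover have "(\<lambda>y. (xi M r x y)\<^sup>2)
      = (\<lambda>y. (measure M (ball x r) powr (-1/2))\<^sup>2 * indicat_real (ball x r) y)"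
    by (auto simp: fun_eq_iff xi_def power_mult_distrib split: split_indicator)
  ultimately show ?thesis
    by (simp only: L2_def mem_Collect_eq)
qed

lemma l2_inner_xi: "l2_inner M f (xi M r x) = measure M (ball x r) powr (-1/2) * (LINT y:ball x r|M. f y)"
proof -
  have "l2_inner M f (xi M r x)
      = (LINT y|M. measure M (ball x r) powr (-1/2) * (indicator (ball x r) y *\<^sub>R f y))"
    unfolding l2_inner_def xi_def by (intro Bochner_Integration.integral_cong) auto
  then show ?thesis
    by (simp add: set_lebesgue_integral_def)
qed

text \<open>Pythagoras on the ball: the mean is the orthogonal projection onto constants, and with
  the normalization of \<open>xi\<close> the squared coefficient is exactly the mass of the constant
  part.\<close>

lemma ball_variance:
  assumes f: "f \<in> L2 M"
  shows "(LINT y:ball x r|M. (f y)\<^sup>2) =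
    (LINT y:ball x r|M. (f y - ball_average M f x r)\<^sup>2) + (l2_inner M f (xi M r x))\<^sup>2"
proof -
  define m where "m = measure M (ball x r)"
  define I where "I = (LINT y:ball x r|M. f y)"
  define v where "v = I / m"
  have m: "0 < m"
    using measure_ball_pos by (simp add: m_def)
  have ind: "(\<lambda>y. indicat_real (ball x r) y) \<in> L2 M"
    using ball_in_sets ball_finite by (simp add: L2_def power2_eq_square flip: indicator_inter_arith)
  have int1: "set_integrable M (ball x r) f"
    using L2_integrable_mult[OF ind f] by (simp add: set_integrable_def)
  have int2: "set_integrable M (ball x r) (\<lambda>y. (f y)\<^sup>2)"
    using integrable_mult_indicator[OF ball_in_sets, of "\<lambda>y. (f y)\<^sup>2"] f
    by (simp add: set_integrable_def L2_def)
  have int0: "set_integrable M (ball x r) (\<lambda>y. v\<^sup>2)"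
    using ball_in_sets ball_finite by (simp add: set_integrable_def)
  have "(LINT y:ball x r|M. (f y - v)\<^sup>2) = (LINT y:ball x r|M. ((f y)\<^sup>2 - 2 * v * f y) + v\<^sup>2)"
    by (simp add: power2_diff algebra_simps)
  also have "\<dots> = (LINT y:ball x r|M. (f y)\<^sup>2) - 2 * v * I + (LINT y:ball x r|M. v\<^sup>2)"
    using int0 int1 int2 by (simp add: I_def)
  also have "(LINT y:ball x r|M. v\<^sup>2) = v\<^sup>2 * m"
    using ball_in_sets by (simp add: m_def set_lebesgue_integral_def)
  also have "(LINT y:ball x r|M. (f y)\<^sup>2) - 2 * v * I + v\<^sup>2 * m = (LINT y:ball x r|M. (f y)\<^sup>2) - I\<^sup>2 / m"
    using m by (simp add: v_def power2_eq_square)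
  finally have "(LINT y:ball x r|M. (f y)\<^sup>2) = (LINT y:ball x r|M. (f y - v)\<^sup>2) + I\<^sup>2 / m"
    by simp
  moreover have "(l2_inner M f (xi M r x))\<^sup>2 = I\<^sup>2 / m"
  proof -
    have "(m powr (-1/2))\<^sup>2 = m powr (-1)"
      by (simp add: power2_eq_square flip: powr_add)
    also have "\<dots> = 1 / m"
      using m by (simp add: powr_minus_divide)
    finally show ?thesis
      unfolding l2_inner_xi m_def[symmetric] I_def[symmetric] power_mult_distrib by simp
  qed
  ultimately show ?thesis
    by (simp add: ball_average_def v_def I_def m_def)
qed

end

text \<open>Turns the local mass of \<open>f\<close> into a finite Borel measure, the form in which
  the lattice lemmas apply to it. This is not the energy measure \<open>\<Gamma> f\<close>.\<close>

lemma energy_density: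
  fixes M :: "'a::metric_space measure"
  assumes f: "f \<in> L2 M" and sets: "sets M = sets borel"
  defines "G \<equiv> density M (\<lambda>y. ennreal ((f y)\<^sup>2))"
  shows "sets G = sets borel" "finite_measure G"
    and "A \<in> sets borel \<Longrightarrow> measure G A = (LINT y:A|M. (f y)\<^sup>2)"
    and "measure G UNIV = (l2_norm M f)\<^sup>2"
proof -
  have space: "space M = UNIV"
    using sets_eq_imp_space_eq[OF sets] by simp
  show sets_G: "sets G = sets borel"
    by (simp add: G_def sets)
  have int: "set_integrable M A (\<lambda>y. (f y)\<^sup>2)" if "A \<in> sets borel" for A
    using integrable_mult_indicator[of A M "\<lambda>y. (f y)\<^sup>2"] f that sets
    by (simp add: set_integrable_def L2_def)
  have emeasure: "emeasure G A = ennreal (LINT y:A|M. (f y)\<^sup>2)" if A: "A \<in> sets borel" for A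
  proof -
    have "emeasure G A = (\<integral>\<^sup>+ y. ennreal (indicator A y *\<^sub>R (f y)\<^sup>2) \<partial>M)"
      unfolding G_def using f A sets
      by (subst emeasure_density) (auto intro!: nn_integral_cong split: split_indicator)
    also have "\<dots> = ennreal (LINT y:A|M. (f y)\<^sup>2)"
      unfolding set_lebesgue_integral_def using int[OF A] unfolding set_integrable_def
      by (intro nn_integral_eq_integral) auto
    finally show ?thesis .
  qed
  show measure: "measure G A = (LINT y:A|M. (f y)\<^sup>2)" if "A \<in> sets borel" for A
    using emeasure[OF that] by (simp add: measure_def set_lebesgue_integral_def)
  show "finite_measure G"
    using emeasure[of UNIV] by (intro finite_measureI) (simp add: G_def space)
  show "measure G UNIV = (l2_norm M f)\<^sup>2"
    using measure[of UNIV] by (simp add: l2_norm_power2 l2_inner_def set_lebesgue_integral_def power2_eq_square[of "f _"])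
qed

section \<open>Sampling in Paley-Wiener spaces\<close>

text \<open>The upper bound discards the variance on each ball and uses the overlap count. In the
  lower bound \<open>small\<close> lets half of the squared norm absorb the energy term.\<close>

lemma sampling_bounds:
  fixes M :: "'a::metric_space measure"
  assumes spectral: "root_spectral_measure M S P"
    and sets: "sets M = sets borel"
    and balls: "\<And>x. emeasure M (ball x \<rho>) < \<infinity>" "\<And>x. 0 < emeasure M (ball x \<rho>)"
    and lattice: "metric_lattice N \<rho> X" "countable X"
    and poincare: "local_poincare M (S O S) \<Gamma> C r\<^sub>0" "0 < C" "0 < \<rho>" "\<rho> \<le> r\<^sub>0"
    and energy: "energy_measure M (Domain S) (root_form M S) \<Gamma>"
    and small: "C * real N * (\<rho> * \<omega>)\<^sup>2 \<le> 1 / 2" "0 < \<omega>"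
    and f: "f \<in> paley_wiener M P \<omega>"
  shows "(\<lambda>x. (l2_inner M f (xi M \<rho> x))\<^sup>2) summable_on X"
    and "(\<Sum>\<^sub>\<infinity>x\<in>X. (l2_inner M f (xi M \<rho> x))\<^sup>2) \<le> real N * (l2_norm M f)\<^sup>2"
    and "1 / 2 * (l2_norm M f)\<^sup>2 \<le> (\<Sum>\<^sub>\<infinity>x\<in>X. (l2_inner M f (xi M \<rho> x))\<^sup>2)"
proof -
  interpret root_spectral_measure M S P
    by (rule spectral)
  define G where "G = density M (\<lambda>y. ennreal ((f y)\<^sup>2))"
  define c where "c = (\<lambda>x. (l2_inner M f (xi M \<rho> x))\<^sup>2)"
  have fL: "f \<in> L2 M"
    using small(2) f by (rule PW_L2)
  have fS: "f \<in> Domain S"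
    using PW_subset_domain[OF small(2)] f by blast
  note G = energy_density[OF fL sets, folded G_def]
  have sets_\<Gamma>: "sets (\<Gamma> f) = sets borel"
    and total: "emeasure (\<Gamma> f) UNIV = ennreal (root_form M S f f)"
    using energy fS unfolding energy_measure_def by blast+
  have finite_\<Gamma>: "finite_measure (\<Gamma> f)"
    using total sets_eq_imp_space_eq[OF sets_\<Gamma>] by (intro finite_measureI) simp
  have "measure (\<Gamma> f) UNIV = root_form M S f f"
    using total by (simp add: measure_def root_form_def)
  then have \<Gamma>_le: "measure (\<Gamma> f) UNIV \<le> \<omega>\<^sup>2 * (l2_norm M f)\<^sup>2"
    using root_form_le[OF small(2) f] by simp
  have variance: "measure G (ball x \<rho>) =
      (LINT y:ball x \<rho>|M. (f y - ball_average M f x \<rho>)\<^sup>2) + c x" for x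
    using ball_variance[OF sets balls fL] G(3)[of "ball x \<rho>"] by (simp add: c_def)
  have c_le: "c x \<le> measure G (ball x \<rho>)" for x
  proof -
    have "0 \<le> (LINT y:ball x \<rho>|M. (f y - ball_average M f x \<rho>)\<^sup>2)"
      unfolding set_lebesgue_integral_def by (intro integral_nonneg_AE) simp
    then show ?thesis
      using variance[of x] by linarith
  qed
  have le_c: "measure G (ball x \<rho>) \<le> C * \<rho>\<^sup>2 * measure (\<Gamma> f) (ball x \<rho>) + c x" for x
  proof -
    have "f \<in> Domain (S O S)"
      using PW_in_domain_square[OF small(2) f] .
    then have "(LINT y:ball x \<rho>|M. (f y - ball_average M f x \<rho>)\<^sup>2)
        \<le> C * \<rho>\<^sup>2 * measure (\<Gamma> f) (ball x \<rho>)"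
      using poincare unfolding local_poincare_def by blast
    then show ?thesis
      using variance[of x] by linarith
  qed
  note G_sums = lattice_summable[OF G(1,2) lattice(1)] lattice_infsum_le[OF G(1,2) lattice(1)]
    lattice_infsum_ge[OF G(1,2) lattice]
  note \<Gamma>_sums = lattice_summable[OF sets_\<Gamma> finite_\<Gamma> lattice(1)]
    lattice_infsum_le[OF sets_\<Gamma> finite_\<Gamma> lattice(1)]
  have c_summable: "c summable_on X"
    using G_sums(1) by (rule summable_on_comparison_test) (auto simp: c_le, simp add: c_def)
  then show "(\<lambda>x. (l2_inner M f (xi M \<rho> x))\<^sup>2) summable_on X"
    by (simp add: c_def)
  have "infsum c X \<le> (\<Sum>\<^sub>\<infinity>x\<in>X. measure G (ball x \<rho>))"
    using c_summable G_sums(1) c_le by (rule infsum_mono)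
  then have "infsum c X \<le> real N * (l2_norm M f)\<^sup>2"
    using G_sums(2) G(4) by simp
  then show "(\<Sum>\<^sub>\<infinity>x\<in>X. (l2_inner M f (xi M \<rho> x))\<^sup>2) \<le> real N * (l2_norm M f)\<^sup>2"
    by (simp add: c_def)
  have "(l2_norm M f)\<^sup>2 \<le> (\<Sum>\<^sub>\<infinity>x\<in>X. measure G (ball x \<rho>))"
    using G_sums(3) G(4) by simp
  also have "\<dots> \<le> (\<Sum>\<^sub>\<infinity>x\<in>X. C * \<rho>\<^sup>2 * measure (\<Gamma> f) (ball x \<rho>) + c x)"
    using G_sums(1) \<Gamma>_sums(1) c_summable le_c
    by (intro infsum_mono summable_on_add summable_on_cmult_right) auto
  also have "\<dots> = C * \<rho>\<^sup>2 * (\<Sum>\<^sub>\<infinity>x\<in>X. measure (\<Gamma> f) (ball x \<rho>)) + infsum c X"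
    using \<Gamma>_sums(1) c_summable
    by (subst infsum_add) (auto intro: summable_on_cmult_right simp: infsum_cmult_right)
  also have "C * \<rho>\<^sup>2 * (\<Sum>\<^sub>\<infinity>x\<in>X. measure (\<Gamma> f) (ball x \<rho>))
      \<le> C * \<rho>\<^sup>2 * (real N * (\<omega>\<^sup>2 * (l2_norm M f)\<^sup>2))"
    using poincare(2) by (intro mult_left_mono order_trans[OF \<Gamma>_sums(2)] \<Gamma>_le) auto
  also have "C * \<rho>\<^sup>2 * (real N * (\<omega>\<^sup>2 * (l2_norm M f)\<^sup>2))
      = C * real N * (\<rho> * \<omega>)\<^sup>2 * (l2_norm M f)\<^sup>2"
    by (simp add: power_mult_distrib)
  also have "\<dots> \<le> 1 / 2 * (l2_norm M f)\<^sup>2"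
    using small(1) by (rule mult_right_mono) simp
  finally show "1 / 2 * (l2_norm M f)\<^sup>2 \<le> (\<Sum>\<^sub>\<infinity>x\<in>X. (l2_inner M f (xi M \<rho> x))\<^sup>2)"
    by (simp add: c_def)
qed

theorem corollary4p1:
  fixes M :: "'a::metric_space measure"
    and D C r\<^sub>0 \<alpha> :: real and N :: nat
    and L S :: "'a l2_graph"
    and P :: "real set \<Rightarrow> ('a \<Rightarrow> real) \<Rightarrow> ('a \<Rightarrow> real)"
    and \<Gamma> :: "('a \<Rightarrow> real) \<Rightarrow> 'a measure"
  assumes "locally_compact_space (euclidean :: 'a topology)"
    and "separable_space (euclidean :: 'a topology)"
    and "radon_measure M" and "0 < D" and "doubling_measure M D"
    and "nonneg_self_adjoint M L"
    and "square_root_of M L S"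
    and "spectral_measure_of M S P"
    and "dirichlet_form M (Domain S) (root_form M S)"
    and "regular_form M (Domain S) (root_form M S)"
    and "strongly_local_form M (Domain S) (root_form M S)"
    and "energy_measure M (Domain S) (root_form M S) \<Gamma>"
    and "0 < C" and "0 < r\<^sub>0" and "local_poincare M L \<Gamma> C r\<^sub>0"
    and "\<exists>\<rho>\<^sub>0>0. \<forall>\<rho>. 0 < \<rho> \<longrightarrow> \<rho> < \<rho>\<^sub>0 \<longrightarrow> (\<exists>X :: 'a set. metric_lattice N \<rho> X)"
    and "0 < \<alpha>"
  shows "\<exists>\<nu>. 0 < \<nu> \<and> \<nu> < 1 \<and>
    (\<forall>\<omega> \<rho>. \<forall>X :: 'a set.
       0 < \<omega> \<longrightarrow>
       (\<rho> = \<nu> * \<omega> powr (-1/2) \<and> \<omega> \<le> 1 \<or> \<rho> = \<nu> * \<omega> powr (-1)) \<longrightarrow>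
       \<rho> \<le> r\<^sub>0 \<longrightarrow> metric_lattice N \<rho> X \<longrightarrow>
       (let H = paley_wiener M P \<omega>; \<theta> = (\<lambda>x. P {0..\<omega>} (xi M \<rho> x)) in
          (\<forall>f\<in>H. \<forall>x\<in>X.
             l2_inner M f (xi M \<rho> x)
               = measure M (ball x \<rho>) powr (-1/2) * (LINT y:ball x \<rho>|M. f y) \<and>
             l2_inner M f (\<theta> x) = l2_inner M f (xi M \<rho> x)) \<and>
          (\<forall>f\<in>H. \<forall>g\<in>H.
             (\<forall>x\<in>X. l2_inner M f (xi M \<rho> x) = l2_inner M g (xi M \<rho> x)) \<longrightarrow> l2_eq M f g) \<and>
          l2_frame M H X \<theta> \<and>
          (\<exists>\<Theta>. dual_frame M H X \<theta> \<Theta>) \<and>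
          (\<forall>\<Theta>. dual_frame M H X \<theta> \<Theta> \<longrightarrow>
             (\<forall>f\<in>H. l2_has_sum M (\<lambda>x y. l2_inner M f (xi M \<rho> x) * \<Theta> x y) X f)) \<and>
          (\<forall>a b. frame_bounds M H X \<theta> a b \<longrightarrow> frame_algorithm_converges M H X \<theta> a b)))"
proof -
  have sets: "sets M = sets borel"
    using \<open>radon_measure M\<close> by (simp add: radon_measure_def)
  have "nonneg_self_adjoint M S" and L: "L = S O S"
    using \<open>square_root_of M L S\<close> by (auto simp: square_root_of_def)
  then interpret root_spectral_measure M S P
    using \<open>spectral_measure_of M S P\<close> by unfold_locales
  \<comment> \<open>Chosen so that \<open>\<nu> < 1\<close> and
    \<open>C * real N * \<nu> \<le> 1 / 2\<close> both hold; since
    \<open>\<nu>\<^sup>2 \<le> \<nu>\<close>, the quadratic smallness condition follows without a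
    square root.\<close>
  define \<nu> where "\<nu> = 1 / (2 + 2 * C * real N)"
  have CN: "0 \<le> C * real N"
    using \<open>0 < C\<close> by simp
  then have \<nu>: "0 < \<nu>" "\<nu> < 1"
    by (auto simp: \<nu>_def field_simps)
  have \<nu>_small: "C * real N * \<nu>\<^sup>2 \<le> 1 / 2"
  proof -
    have "\<nu>\<^sup>2 \<le> \<nu>"
      using \<nu> by (simp add: power2_eq_square mult_left_le)
    then have "C * real N * \<nu>\<^sup>2 \<le> C * real N * \<nu>"
      using CN by (rule mult_left_mono)
    also have "\<dots> \<le> 1 / 2"
      using CN by (simp add: \<nu>_def field_simps)
    finally show ?thesis .
  qed
  show ?thesis
  proof (intro exI[of _ \<nu>] conjI \<nu> allI impI)
    fix \<omega> \<rho> :: real and X :: "'a set"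
    assume \<omega>: "0 < \<omega>"
      and \<rho>: "\<rho> = \<nu> * \<omega> powr (-1/2) \<and> \<omega> \<le> 1 \<or> \<rho> = \<nu> * \<omega> powr (-1)"
      and "\<rho> \<le> r\<^sub>0" and lattice: "metric_lattice N \<rho> X"
    have "0 < \<rho>"
      using \<rho> \<omega> \<nu> by auto
    have "\<rho> * \<omega> \<le> \<nu>"
    proof -
      have "\<omega> powr p * \<omega> = \<omega> powr (p + 1)" for p
        using \<omega> by (simp add: powr_add)
      then have "\<rho> * \<omega> = \<nu> * \<omega> powr (1/2) \<and> \<omega> \<le> 1 \<or> \<rho> * \<omega> = \<nu>"
        using \<rho> \<omega> by (auto simp: mult.assoc)
      moreover have "\<nu> * \<omega> powr (1/2) \<le> \<nu>" if "\<omega> \<le> 1"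
        using that \<omega> \<nu> by (simp add: powr_le1)
      ultimately show ?thesis by auto
    qed
    then have "(\<rho> * \<omega>)\<^sup>2 \<le> \<nu>\<^sup>2"
      using \<open>0 < \<rho>\<close> \<omega> by (intro power_mono) auto
    then have small: "C * real N * (\<rho> * \<omega>)\<^sup>2 \<le> 1 / 2"
      using CN \<nu>_small by (meson mult_left_mono order_trans)
    define H where "H = paley_wiener M P \<omega>"
    \<comment> \<open>A frame of \<open>H\<close> has to consist of elements of \<open>H\<close>, so
      the normalized indicators are projected.\<close>
    define \<theta> where "\<theta> = (\<lambda>x. P {0..\<omega>} (xi M \<rho> x))"
    interpret l2_hilbert M H
      unfolding H_def using \<omega> \<open>dirichlet_form M (Domain S) (root_form M S)\<close> by (rule PW_hilbert)
    have balls: "emeasure M (ball x \<rho>) < \<infinity>" "0 < emeasure M (ball x \<rho>)" for x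
      using doubling_ball_finite[OF assms(1) \<open>radon_measure M\<close> \<open>doubling_measure M D\<close>]
        doubling_ball_pos[OF \<open>doubling_measure M D\<close> \<open>0 < \<rho>\<close>] by blast+
    have xi: "xi M \<rho> x \<in> L2 M" for x
      using sets balls by (rule xi_in_L2)
    have \<theta>_in: "\<theta> x \<in> H" for x
      unfolding H_def \<theta>_def using \<omega> xi by (rule Q_in_PW)
    have inner_\<theta>: "l2_inner M f (\<theta> x) = l2_inner M f (xi M \<rho> x)" if "f \<in> H" for f x
      using that \<omega> xi Q_inner[OF \<omega>, of f "xi M \<rho> x"] P_symmetric[of "{0..\<omega>}" f "xi M \<rho> x"]
      by (simp add: \<theta>_def H_def)
    \<comment> \<open>The sampling estimate gives the upper constant \<open>real N\<close>; adding 1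
      makes it evidently at least the lower constant \<open>1 / 2\<close>.\<close>
    have frame: "frame_bounds M H X \<theta> (1 / 2) (real N + 1)"
      unfolding frame_bounds_def
    proof (intro conjI ballI)
      fix f assume f: "f \<in> H"
      note bounds = sampling_bounds[OF root_spectral_measure_axioms sets balls lattice
          metric_lattice_countable[OF assms(2) lattice \<open>0 < \<rho>\<close>]
          \<open>local_poincare M L \<Gamma> C r\<^sub>0\<close>[unfolded L] \<open>0 < C\<close> \<open>0 < \<rho>\<close> \<open>\<rho> \<le> r\<^sub>0\<close>
          \<open>energy_measure M (Domain S) (root_form M S) \<Gamma>\<close> small \<omega> f[unfolded H_def]]
      show "(\<lambda>x. (l2_inner M f (\<theta> x))\<^sup>2) summable_on X"
        "1 / 2 * (l2_norm M f)\<^sup>2 \<le> (\<Sum>\<^sub>\<infinity>x\<in>X. (l2_inner M f (\<theta> x))\<^sup>2)"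
        unfolding inner_\<theta>[OF f] by (rule bounds)+
      have "real N * (l2_norm M f)\<^sup>2 \<le> (real N + 1) * (l2_norm M f)\<^sup>2"
        by (intro mult_right_mono) auto
      with bounds(2) show "(\<Sum>\<^sub>\<infinity>x\<in>X. (l2_inner M f (\<theta> x))\<^sup>2) \<le> (real N + 1) * (l2_norm M f)\<^sup>2"
        unfolding inner_\<theta>[OF f] by (rule order_trans)
    qed (auto simp: \<theta>_in)
    then interpret frame: l2_frame_space M H X \<theta> "1 / 2" "real N + 1"
      by unfold_locales
    have averages: "l2_inner M f (xi M \<rho> x)
        = measure M (ball x \<rho>) powr (-1/2) * (LINT y:ball x \<rho>|M. f y)" for f x
      using sets balls by (rule l2_inner_xi)
    \<comment> \<open>The difference of two functions with equal averages has zero coefficients, and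
      the lower frame bound makes it null.\<close>
    have unique: "l2_eq M f g"
      if f: "f \<in> H" and g: "g \<in> H"
        and eq: "\<forall>x\<in>X. l2_inner M f (xi M \<rho> x) = l2_inner M g (xi M \<rho> x)" for f g
    proof -
      have "l2_inner M (\<lambda>x. f x - g x) (\<theta> x) = 0" if "x \<in> X" for x
        using f g eq that \<theta>_in[of x] by (simp add: inner_\<theta>)
      then have "(\<Sum>\<^sub>\<infinity>x\<in>X. (l2_inner M (\<lambda>x. f x - g x) (\<theta> x))\<^sup>2) = 0"
        by (intro infsum_0) simp
      moreover have "1 / 2 * (l2_norm M (\<lambda>x. f x - g x))\<^sup>2
          \<le> (\<Sum>\<^sub>\<infinity>x\<in>X. (l2_inner M (\<lambda>x. f x - g x) (\<theta> x))\<^sup>2)"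
        using frame diff_in[OF f g] unfolding frame_bounds_def by blast
      ultimately have "l2_norm M (\<lambda>x. f x - g x) = 0"
        by simp
      then show ?thesis
        using f g by (simp add: l2_eq_iff_norm)
    qed
    have reconstruction: "l2_has_sum M (\<lambda>x y. l2_inner M f (xi M \<rho> x) * \<Theta> x y) X f"
      if "dual_frame M H X \<theta> \<Theta>" "f \<in> H" for \<Theta> f
      using that unfolding dual_frame_def by (auto simp: inner_\<theta>)
    \<comment> \<open>The claim concerns arbitrary frame bounds, not just those found above, so the
      frame theory is instantiated afresh with \<open>a\<close> and \<open>b\<close>.\<close>
    have algorithm: "frame_algorithm_converges M H X \<theta> a b" if "frame_bounds M H X \<theta> a b" for a b
    proof -
      from that interpret l2_frame_space M H X \<theta> a b
        by unfold_locales
      show ?thesis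
        by (rule frame_algorithm_converges)
    qed
    have "l2_frame M H X \<theta>"
      using frame by (auto simp: l2_frame_def)
    then show "let H = paley_wiener M P \<omega>; \<theta> = (\<lambda>x. P {0..\<omega>} (xi M \<rho> x)) in
          (\<forall>f\<in>H. \<forall>x\<in>X.
             l2_inner M f (xi M \<rho> x)
               = measure M (ball x \<rho>) powr (-1/2) * (LINT y:ball x \<rho>|M. f y) \<and>
             l2_inner M f (\<theta> x) = l2_inner M f (xi M \<rho> x)) \<and>
          (\<forall>f\<in>H. \<forall>g\<in>H.
             (\<forall>x\<in>X. l2_inner M f (xi M \<rho> x) = l2_inner M g (xi M \<rho> x)) \<longrightarrow> l2_eq M f g) \<and>
          l2_frame M H X \<theta> \<and>
          (\<exists>\<Theta>. dual_frame M H X \<theta> \<Theta>) \<and>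
          (\<forall>\<Theta>. dual_frame M H X \<theta> \<Theta> \<longrightarrow>
             (\<forall>f\<in>H. l2_has_sum M (\<lambda>x y. l2_inner M f (xi M \<rho> x) * \<Theta> x y) X f)) \<and>
          (\<forall>a b. frame_bounds M H X \<theta> a b \<longrightarrow> frame_algorithm_converges M H X \<theta> a b)"
      unfolding Let_def H_def[symmetric] \<theta>_def[symmetric]
      using averages inner_\<theta> unique frame.canonical_dual_frame reconstruction algorithm by blast
  qed
qed

end
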